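(* Let $p$ be an odd prime and let $\alpha,\beta\in\mathbb{Q}_p$ be algebraically dependent; let $F(X,Y)\in\mathbb{Q}[X,Y]$ be a non-zero polynomial of minimum total degree $D$ such that $F(\alpha,\beta)=0$. Suppose the $p$-adic MCF expansion $[(a_0,a_1,\ldots),(b_0,b_1,\ldots)]$ of $(\alpha,\beta)$ satisfies, for all sufficiently large $n$, \[k_{n+1}\geq(D-1)(k_n+k_{n-1})+2D\quad\text{and}\quad h_{n+1}\geq(D-1)k_n+D.\] Then $F(Q_n^\alpha,Q_n^\beta)=0$ for all sufficiently large $n$.
   Context: $\nu_p$ denotes the $p$-adic valuation. Browkin's $s$-function $s:\mathbb{Q}_p\to\mathbb{Z}[1/p]\cap(-p/2,p/2)$ is $s(\alpha)=\sum_{j=k}^{0}x_jp^j$ where $\alpha=\sum_{j=k}^\infty x_jp^j$, $x_j\in\mathbb{Z}\cap(-p/2,p/2)$ (empty sum $=0$ if $k>0$). The $p$-adic Jacobi–Perron algorithm applied to $(\alpha,\beta)$: $\alpha_0=\alpha,\beta_0=\beta$, and for $k\geq0$: $a_k=s(\alpha_k)$, $b_k=s(\beta_k)$, and if $\beta_k\neq b_k$, $\alpha_{k+1}=1/(\beta_k-b_k)$, $\beta_{k+1}=(\alpha_k-a_k)/(\beta_k-b_k)$; if $\beta_k=b_k$ it stops. Define $A_{-2}=0,A_{-1}=1,A_0=a_0$; $B_{-2}=1,B_{-1}=0,B_0=b_0$; $C_{-2}=0,C_{-1}=0,C_0=1$, and for $n\geq1$: $X_n=a_nX_{n-1}+b_nX_{n-2}+X_{n-3}$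 for $X\in\{A,B,C\}$; $Q_n^\alpha=A_n/C_n$, $Q_n^\beta=B_n/C_n$. For $n\geq1$: $k_n=\nu_p(1/a_n)$, $h_n=\nu_p(b_n/a_n)$ ($=+\infty$ if $b_n=0$). *)

theory Defs
  imports "HOL-Analysis.Analysis" "HOL-Computational_Algebra.Computational_Algebra"
begin

section \<open>The p-adic valuation and absolute value on the rationals\<close>

text \<open>On nonzero rationals this is the usual valuation; the value at 0 is irrelevant, the convention
  $\nu_p(0) = \infty$ is built into \<open>padic_valuation\<close>.\<close>

definition padic_ord :: "nat \<Rightarrow> rat \<Rightarrow> int" where
  "padic_ord p x = int (multiplicity (int p) (fst (quotient_of x)))
                 - int (multiplicity (int p) (snd (quotient_of x)))"

definition padic_valuation :: "nat \<Rightarrow> rat \<Rightarrow> ereal" where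
  "padic_valuation p x = (if x = 0 then \<infinity> else ereal (real_of_int (padic_ord p x)))"

definition padic_abs :: "nat \<Rightarrow> rat \<Rightarrow> real" where
  "padic_abs p x = (if x = 0 then 0 else real p powi (- padic_ord p x))"

lemma padic_ord_divide:
  assumes p: "prime p" and "a \<noteq> 0" "b \<noteq> 0"
  shows "padic_ord p (of_int a / of_int b) =
           int (multiplicity (int p) a) - int (multiplicity (int p) b)"
proof -
  define x :: rat where "x = of_int a / of_int b"
  obtain c d where q: "quotient_of x = (c, d)" by (cases "quotient_of x")
  have d: "d > 0" and x: "x = of_int c / of_int d"
    using quotient_of_denom_pos[OF q] quotient_of_div[OF q] by auto
  have "x \<noteq> 0" using assms by (simp add: x_def)
  hence c: "c \<noteq> 0" using x by auto
  have "(of_int (a * d) :: rat) = of_int (c * b)"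
    using x x_def d assms by (simp add: field_simps)
  hence eq: "a * d = c * b" by (simp only: of_int_eq_iff)
  have P: "prime_elem (int p)" using p by simp
  have "multiplicity (int p) a + multiplicity (int p) d
      = multiplicity (int p) c + multiplicity (int p) b"
    using arg_cong[OF eq, of "multiplicity (int p)"] P c d assms
    by (simp add: prime_elem_multiplicity_mult_distrib)
  thus ?thesis using q by (simp add: padic_ord_def flip: x_def)
qed

lemma rat_as_fraction:
  fixes x :: rat
  obtains a b :: int where "x = of_int a / of_int b" "b \<noteq> 0"
proof -
  obtain c d where q: "quotient_of x = (c, d)" by (cases "quotient_of x")
  show ?thesis
    using that[of c d] quotient_of_denom_pos[OF q] quotient_of_div[OF q] by auto
qed

lemma padic_ord_mult:
  assumes p: "prime p" and "x \<noteq> 0" "y \<noteq> 0"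
  shows "padic_ord p (x * y) = padic_ord p x + padic_ord p y"
proof -
  obtain a b where x: "x = of_int a / of_int b" "b \<noteq> 0" by (rule rat_as_fraction)
  obtain c d where y: "y = of_int c / of_int d" "d \<noteq> 0" by (rule rat_as_fraction)
  have nz: "a \<noteq> 0" "c \<noteq> 0" using x y assms by auto
  have "x * y = of_int (a * c) / of_int (b * d)" using x y by simp
  thus ?thesis
    using x y nz p padic_ord_divide[OF p, of "a * c" "b * d"]
    by (simp add: padic_ord_divide prime_elem_multiplicity_mult_distrib)
qed

lemma padic_ord_add:
  assumes p: "prime p" and "x \<noteq> 0" "y \<noteq> 0" "x + y \<noteq> 0"
  shows "padic_ord p (x + y) \<ge> min (padic_ord p x) (padic_ord p y)"
proof -
  obtain a b where x: "x = of_int a / of_int b" "b \<noteq> 0" by (rule rat_as_fraction)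
  obtain c d where y: "y = of_int c / of_int d" "d \<noteq> 0" by (rule rat_as_fraction)
  have x': "x = of_int (a * d) / of_int (b * d)" and y': "y = of_int (c * b) / of_int (b * d)"
    using x y by simp_all
  hence s: "x + y = of_int (a * d + c * b) / of_int (b * d)"
    by (simp add: add_divide_distrib)
  have nz: "a * d \<noteq> 0" "c * b \<noteq> 0" "a * d + c * b \<noteq> 0" "b * d \<noteq> 0"
  proof -
    show "a * d \<noteq> 0" "c * b \<noteq> 0" "b * d \<noteq> 0" using x y assms by auto
    show "a * d + c * b \<noteq> 0" using s assms(4) by (metis div_0 of_int_0)
  qed
  let ?m = "multiplicity (int p)"
  have "int p ^ min (?m (a * d)) (?m (c * b)) dvd a * d + c * b"
    by (intro dvd_add multiplicity_dvd') auto
  hence "min (?m (a * d)) (?m (c * b)) \<le> ?m (a * d + c * b)"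
    using nz p by (intro multiplicity_geI) (auto simp: prime_gt_1_nat)
  thus ?thesis
    unfolding s using x' y' nz padic_ord_divide[OF p nz(1,4)] padic_ord_divide[OF p nz(2,4)]
      padic_ord_divide[OF p nz(3,4)] by simp
qed

lemma padic_abs_0 [simp]: "padic_abs p 0 = 0"
  by (simp add: padic_abs_def)

lemma padic_abs_nonneg [simp]: "padic_abs p x \<ge> 0"
  by (simp add: padic_abs_def)

lemma padic_abs_1 [simp]: "prime p \<Longrightarrow> padic_abs p 1 = 1"
  using padic_ord_divide[of p 1 1] by (simp add: padic_abs_def)

lemma padic_abs_eq_0_iff [simp]: "prime p \<Longrightarrow> padic_abs p x = 0 \<longleftrightarrow> x = 0"
  by (auto simp: padic_abs_def power_int_eq_0_iff prime_gt_0_nat)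

lemma padic_abs_mult:
  assumes p: "prime p" shows "padic_abs p (x * y) = padic_abs p x * padic_abs p y"
proof (cases "x = 0 \<or> y = 0")
  case False
  thus ?thesis using p prime_gt_0_nat[OF p]
    by (simp add: padic_abs_def padic_ord_mult power_int_add power_int_diff power_int_minus
        field_simps)
qed auto

lemma padic_abs_minus [simp]: "prime p \<Longrightarrow> padic_abs p (- x) = padic_abs p x"
proof -
  assume p: "prime p"
  have "padic_abs p (-1) * padic_abs p (-1) = 1"
    using padic_abs_mult[OF p, of "-1" "-1"] p by simp
  hence "padic_abs p (-1) = 1"
    using padic_abs_nonneg[of p "-1"] by (metis abs_of_nonneg real_sqrt_abs2 real_sqrt_one)
  thus ?thesis using padic_abs_mult[OF p, of "-1" x] by simp
qed

lemma padic_abs_diff_commute: "prime p \<Longrightarrow> padic_abs p (x - y) = padic_abs p (y - x)"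
  using padic_abs_minus[of p "x - y"] by simp

lemma padic_abs_add_le_max:
  assumes p: "prime p" shows "padic_abs p (x + y) \<le> max (padic_abs p x) (padic_abs p y)"
proof (cases "x = 0 \<or> y = 0 \<or> x + y = 0")
  case True
  thus ?thesis by (auto simp: le_max_iff_disj)
next
  case False
  have p1: "real p \<ge> 1" using prime_gt_1_nat[OF p] by simp
  from False have "- padic_ord p (x + y) \<le> max (- padic_ord p x) (- padic_ord p y)"
    using padic_ord_add[OF p, of x y] by linarith
  hence "- padic_ord p (x + y) \<le> - padic_ord p x \<or> - padic_ord p (x + y) \<le> - padic_ord p y"
    by linarith
  thus ?thesis using False p1
    by (auto simp: padic_abs_def le_max_iff_disj intro: power_int_increasing)
qed

lemma padic_abs_add_le: "prime p \<Longrightarrow> padic_abs p (x + y) \<le> padic_abs p x + padic_abs p y"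
  using padic_abs_add_le_max[of p x y] padic_abs_nonneg[of p x] padic_abs_nonneg[of p y]
  by linarith

lemma padic_abs_diff_abs_le:
  assumes p: "prime p" shows "\<bar>padic_abs p x - padic_abs p y\<bar> \<le> padic_abs p (x - y)"
  using padic_abs_add_le[OF p, of "x - y" y] padic_abs_add_le[OF p, of "y - x" x]
    padic_abs_diff_commute[OF p, of x y] by simp


section \<open>The field of p-adic numbers\<close>

text \<open>The prime is carried by the type: \<open>'p padic\<close> is $\mathbb{Q}_p$ for \<open>p = CARD('p)\<close>, constructed as the
  ring of $p$-adic Cauchy sequences of rationals modulo the null sequences.\<close>

definition padic_Cauchy :: "nat \<Rightarrow> (nat \<Rightarrow> rat) \<Rightarrow> bool" where
  "padic_Cauchy p X \<longleftrightarrow> (\<forall>e>0. \<exists>N. \<forall>m\<ge>N. \<forall>n\<ge>N. padic_abs p (X m - X n) < e)"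

lemma padic_Cauchy_const [simp]: "padic_Cauchy p (\<lambda>_. c)"
  by (auto simp: padic_Cauchy_def)

lemma padic_Cauchy_add:
  assumes p: "prime p" and X: "padic_Cauchy p X" and Y: "padic_Cauchy p Y"
  shows "padic_Cauchy p (\<lambda>n. X n + Y n)"
  unfolding padic_Cauchy_def
proof (intro allI impI)
  fix e :: real assume e: "e > 0"
  obtain M where M: "\<And>m n. m \<ge> M \<Longrightarrow> n \<ge> M \<Longrightarrow> padic_abs p (X m - X n) < e"
    using X e unfolding padic_Cauchy_def by meson
  obtain N where N: "\<And>m n. m \<ge> N \<Longrightarrow> n \<ge> N \<Longrightarrow> padic_abs p (Y m - Y n) < e"
    using Y e unfolding padic_Cauchy_def by meson
  show "\<exists>K. \<forall>m\<ge>K. \<forall>n\<ge>K. padic_abs p (X m + Y m - (X n + Y n)) < e"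
  proof (intro exI allI impI)
    fix m n assume mn: "m \<ge> max M N" "n \<ge> max M N"
    have "padic_abs p (X m + Y m - (X n + Y n))
        \<le> max (padic_abs p (X m - X n)) (padic_abs p (Y m - Y n))"
      using padic_abs_add_le_max[OF p, of "X m - X n" "Y m - Y n"] by (simp add: algebra_simps)
    also have "\<dots> < e" using M N mn by auto
    finally show "padic_abs p (X m + Y m - (X n + Y n)) < e" .
  qed
qed

lemma padic_Cauchy_minus:
  assumes p: "prime p" and X: "padic_Cauchy p X" shows "padic_Cauchy p (\<lambda>n. - X n)"
proof -
  have "padic_abs p (- X m - - X n) = padic_abs p (X m - X n)" for m n
    using padic_abs_minus[OF p, of "X m - X n"] by simp
  thus ?thesis using X by (simp add: padic_Cauchy_def)
qed

lemma padic_Cauchy_imp_convergent_abs: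
  assumes p: "prime p" and X: "padic_Cauchy p X"
  shows "convergent (\<lambda>n. padic_abs p (X n))"
proof -
  have "Cauchy (\<lambda>n. padic_abs p (X n))"
    unfolding Cauchy_def dist_real_def
    using X padic_abs_diff_abs_le[OF p] unfolding padic_Cauchy_def by (meson le_less_trans)
  thus ?thesis by (simp add: Cauchy_convergent_iff)
qed

lemma padic_Cauchy_bounded:
  assumes p: "prime p" and X: "padic_Cauchy p X"
  obtains B where "B > 0" "\<And>n. padic_abs p (X n) < B"
proof -
  have "Bseq (\<lambda>n. padic_abs p (X n))"
    using padic_Cauchy_imp_convergent_abs[OF p X] by (rule convergent_imp_Bseq)
  then obtain K where "K > 0" "\<And>n. norm (padic_abs p (X n)) \<le> K" by (auto simp: Bseq_def)
  hence "K + 1 > 0" "\<And>n. padic_abs p (X n) < K + 1"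
    by (auto simp: less_le_trans) (metis add.commute add_strict_increasing zero_less_one)
  thus ?thesis using that by blast
qed

lemma padic_Cauchy_mult:
  assumes p: "prime p" and X: "padic_Cauchy p X" and Y: "padic_Cauchy p Y"
  shows "padic_Cauchy p (\<lambda>n. X n * Y n)"
  unfolding padic_Cauchy_def
proof (intro allI impI)
  fix e :: real assume e: "e > 0"
  obtain A where A: "A > 0" "\<And>n. padic_abs p (X n) < A" using padic_Cauchy_bounded[OF p X] by blast
  obtain B where B: "B > 0" "\<And>n. padic_abs p (Y n) < B" using padic_Cauchy_bounded[OF p Y] by blast
  obtain M where M: "\<And>m n. m \<ge> M \<Longrightarrow> n \<ge> M \<Longrightarrow> padic_abs p (X m - X n) < e / B"
    using X e B unfolding padic_Cauchy_def by (meson divide_pos_pos)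
  obtain N where N: "\<And>m n. m \<ge> N \<Longrightarrow> n \<ge> N \<Longrightarrow> padic_abs p (Y m - Y n) < e / A"
    using Y e A unfolding padic_Cauchy_def by (meson divide_pos_pos)
  show "\<exists>K. \<forall>m\<ge>K. \<forall>n\<ge>K. padic_abs p (X m * Y m - X n * Y n) < e"
  proof (intro exI allI impI)
    fix m n assume mn: "m \<ge> max M N" "n \<ge> max M N"
    have "padic_abs p (X m * Y m - X n * Y n)
        \<le> max (padic_abs p ((X m - X n) * Y m)) (padic_abs p (X n * (Y m - Y n)))"
      using padic_abs_add_le_max[OF p, of "(X m - X n) * Y m" "X n * (Y m - Y n)"]
      by (simp add: algebra_simps)
    also have "padic_abs p ((X m - X n) * Y m) < e / B * B"
      unfolding padic_abs_mult[OF p] using M[of m n] B mn e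
      by (intro mult_strict_mono) auto
    hence "max (padic_abs p ((X m - X n) * Y m)) (padic_abs p (X n * (Y m - Y n))) < e"
    proof -
      assume 1: "padic_abs p ((X m - X n) * Y m) < e / B * B"
      have 2: "padic_abs p (X n * (Y m - Y n)) < A * (e / A)"
        unfolding padic_abs_mult[OF p] using N[of m n] A mn
        by (intro mult_strict_mono) auto
      show ?thesis using 1 2 A B by simp
    qed
    finally show "padic_abs p (X m * Y m - X n * Y n) < e" .
  qed
qed

class prime_card = finite +
  assumes prime_card: "prime CARD('a)"

typedef ('p::prime_card) padic_seq = "{X :: nat \<Rightarrow> rat. padic_Cauchy CARD('p) X}"
  by (rule exI[of _ "\<lambda>_. 0"]) simp

setup_lifting type_definition_padic_seq

instantiation padic_seq :: (prime_card) comm_ring_1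
begin

lift_definition zero_padic_seq :: "'a padic_seq" is "\<lambda>_. 0" by simp

lift_definition one_padic_seq :: "'a padic_seq" is "\<lambda>_. 1" by simp

lift_definition plus_padic_seq :: "'a padic_seq \<Rightarrow> 'a padic_seq \<Rightarrow> 'a padic_seq"
  is "\<lambda>X Y n. X n + Y n" by (rule padic_Cauchy_add[OF prime_card])

lift_definition uminus_padic_seq :: "'a padic_seq \<Rightarrow> 'a padic_seq"
  is "\<lambda>X n. - X n" by (rule padic_Cauchy_minus[OF prime_card])

lift_definition minus_padic_seq :: "'a padic_seq \<Rightarrow> 'a padic_seq \<Rightarrow> 'a padic_seq"
  is "\<lambda>X Y n. X n - Y n"
  using padic_Cauchy_add[OF prime_card _ padic_Cauchy_minus[OF prime_card]] by simp

lift_definition times_padic_seq :: "'a padic_seq \<Rightarrow> 'a padic_seq \<Rightarrow> 'a padic_seq"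
  is "\<lambda>X Y n. X n * Y n" by (rule padic_Cauchy_mult[OF prime_card])

instance
proof
  show "(0 :: 'a padic_seq) \<noteq> 1" by transfer (simp add: fun_eq_iff)
qed (transfer; simp add: fun_eq_iff algebra_simps)+

end

lift_definition padic_seq_nth :: "'p::prime_card padic_seq \<Rightarrow> nat \<Rightarrow> rat" is "\<lambda>X n. X n" .

definition padic_seq_norm :: "'p::prime_card padic_seq \<Rightarrow> real" where
  "padic_seq_norm X = lim (\<lambda>n. padic_abs CARD('p) (padic_seq_nth X n))"

lemma padic_seq_nth_simps [simp]:
  "padic_seq_nth 0 n = 0" "padic_seq_nth 1 n = 1"
  "padic_seq_nth (X + Y) n = padic_seq_nth X n + padic_seq_nth Y n"
  "padic_seq_nth (X - Y) n = padic_seq_nth X n - padic_seq_nth Y n"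
  "padic_seq_nth (- X) n = - padic_seq_nth X n"
  "padic_seq_nth (X * Y) n = padic_seq_nth X n * padic_seq_nth Y n"
  by (transfer; simp)+

lemma padic_Cauchy_nth: "padic_Cauchy CARD('p) (padic_seq_nth (X :: 'p::prime_card padic_seq))"
  by transfer simp

lemma tendsto_padic_seq_norm:
  "(\<lambda>n. padic_abs CARD('p) (padic_seq_nth X n)) \<longlonglongrightarrow> padic_seq_norm (X :: 'p::prime_card padic_seq)"
  unfolding padic_seq_norm_def convergent_LIMSEQ_iff[symmetric]
  by (rule padic_Cauchy_imp_convergent_abs[OF prime_card padic_Cauchy_nth])

lemma padic_seq_norm_eqI:
  "(\<lambda>n. padic_abs CARD('p) (padic_seq_nth X n)) \<longlonglongrightarrow> c \<Longrightarrow> padic_seq_norm (X :: 'p::prime_card padic_seq) = c"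
  using tendsto_padic_seq_norm LIMSEQ_unique by blast

lemma padic_seq_norm_nonneg [simp]: "padic_seq_norm X \<ge> 0"
  by (rule LIMSEQ_le_const[OF tendsto_padic_seq_norm]) auto

lemma padic_seq_norm_mult: "padic_seq_norm (X * Y) = padic_seq_norm X * padic_seq_norm Y"
  for X Y :: "'p::prime_card padic_seq"
  by (rule padic_seq_norm_eqI)
     (simp add: padic_abs_mult[OF prime_card] tendsto_mult tendsto_padic_seq_norm)

lemma padic_seq_norm_minus [simp]: "padic_seq_norm (- X) = padic_seq_norm X"
  for X :: "'p::prime_card padic_seq"
  by (rule padic_seq_norm_eqI)
     (simp add: padic_abs_minus[OF prime_card] tendsto_padic_seq_norm)

lemma padic_seq_norm_0 [simp]: "padic_seq_norm 0 = 0"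
  by (rule padic_seq_norm_eqI) simp

lemma padic_seq_norm_1 [simp]: "padic_seq_norm (1 :: 'p::prime_card padic_seq) = 1"
  by (rule padic_seq_norm_eqI) (simp add: padic_abs_1[OF prime_card])

lemma padic_seq_norm_add: "padic_seq_norm (X + Y) \<le> max (padic_seq_norm X) (padic_seq_norm Y)"
  for X Y :: "'p::prime_card padic_seq"
  by (rule LIMSEQ_le[OF tendsto_padic_seq_norm
        tendsto_max[OF tendsto_padic_seq_norm[of X] tendsto_padic_seq_norm[of Y]]])
     (auto intro!: padic_abs_add_le_max[OF prime_card])

lemma padic_seq_norm_diff_commute: "padic_seq_norm (X - Y) = padic_seq_norm (Y - X)"
  for X Y :: "'p::prime_card padic_seq"
  using padic_seq_norm_minus[of "X - Y"] by simp

lemma padic_seq_norm_diff_eq_0_imp: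
  fixes X Y :: "'p::prime_card padic_seq"
  assumes "padic_seq_norm (X - Y) = 0" shows "padic_seq_norm X = padic_seq_norm Y"
proof -
  have "padic_seq_norm X \<le> padic_seq_norm Y" if "padic_seq_norm (X - Y) = 0"
    for X Y :: "'p padic_seq"
    using padic_seq_norm_add[of "X - Y" Y] that by simp
  from this[of X Y] this[of Y X] assms show ?thesis
    by (simp add: padic_seq_norm_diff_commute)
qed

lemma padic_Cauchy_inverse:
  assumes p: "prime p" and X: "padic_Cauchy p X"
    and c: "c > 0" and N0: "\<And>n. n \<ge> N0 \<Longrightarrow> padic_abs p (X n) > c"
  shows "padic_Cauchy p (\<lambda>n. inverse (X n))"
  unfolding padic_Cauchy_def
proof (intro allI impI)
  fix e :: real assume e: "e > 0"
  have "e * c * c > 0" using e c by simp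
  then obtain M where M: "\<And>m n. m \<ge> M \<Longrightarrow> n \<ge> M \<Longrightarrow> padic_abs p (X m - X n) < e * c * c"
    using X unfolding padic_Cauchy_def by meson
  show "\<exists>K. \<forall>m\<ge>K. \<forall>n\<ge>K. padic_abs p (inverse (X m) - inverse (X n)) < e"
  proof (intro exI allI impI)
    fix m n assume mn: "m \<ge> max M N0" "n \<ge> max M N0"
    have gt: "padic_abs p (X m) > c" "padic_abs p (X n) > c" using N0 mn by auto
    have nz: "X m \<noteq> 0" "X n \<noteq> 0" using gt c by auto
    have "X n - X m = (inverse (X m) - inverse (X n)) * (X m * X n)"
      using nz by (simp add: field_simps)
    hence "padic_abs p (X n - X m) =
        padic_abs p (inverse (X m) - inverse (X n)) * (padic_abs p (X m) * padic_abs p (X n))"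
      by (simp add: padic_abs_mult[OF p])
    hence lt: "padic_abs p (inverse (X m) - inverse (X n)) * (padic_abs p (X m) * padic_abs p (X n))
        < e * (c * c)"
      using M[of n m] mn by (simp add: mult.assoc)
    have "c * c \<le> padic_abs p (X m) * padic_abs p (X n)"
      using gt c by (intro mult_mono) auto
    show "padic_abs p (inverse (X m) - inverse (X n)) < e"
    proof (rule ccontr)
      assume "\<not> ?thesis"
      hence "e * (c * c) \<le>
          padic_abs p (inverse (X m) - inverse (X n)) * (padic_abs p (X m) * padic_abs p (X n))"
        using \<open>c * c \<le> _\<close> e c gt by (intro mult_mono) auto
      with lt show False by simp
    qed
  qed
qed

lemma padic_seq_inverse_exists:
  fixes X :: "'p::prime_card padic_seq"
  assumes "padic_seq_norm X \<noteq> 0"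
  shows "\<exists>Y. padic_seq_norm (Y * X - 1) = 0"
proof -
  define c where "c = padic_seq_norm X / 2"
  have c: "c > 0" "c < padic_seq_norm X"
    using assms padic_seq_norm_nonneg[of X] by (auto simp: c_def less_le)
  obtain N where N: "\<And>n. n \<ge> N \<Longrightarrow> padic_abs CARD('p) (padic_seq_nth X n) > c"
    using order_tendstoD(1)[OF tendsto_padic_seq_norm c(2)] by (auto simp: eventually_sequentially)
  have "padic_Cauchy CARD('p) (\<lambda>n. inverse (padic_seq_nth X n))"
    using padic_Cauchy_inverse[OF prime_card padic_Cauchy_nth c(1) N] .
  then obtain Y :: "'p padic_seq" where Y: "\<And>n. padic_seq_nth Y n = inverse (padic_seq_nth X n)"
    by (metis Abs_padic_seq_inverse mem_Collect_eq padic_seq_nth.rep_eq)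
  have "\<forall>n\<ge>N. padic_abs CARD('p) (padic_seq_nth (Y * X - 1) n) = 0"
  proof (intro allI impI)
    fix n assume "n \<ge> N"
    hence "padic_seq_nth X n \<noteq> 0" using N[of n] c by auto
    thus "padic_abs CARD('p) (padic_seq_nth (Y * X - 1) n) = 0" by (simp add: Y)
  qed
  hence "(\<lambda>n. padic_abs CARD('p) (padic_seq_nth (Y * X - 1) n)) \<longlonglongrightarrow> 0"
    by (intro tendsto_eventually) (auto simp: eventually_sequentially)
  thus ?thesis using padic_seq_norm_eqI by blast
qed

definition padic_rel :: "'p::prime_card padic_seq \<Rightarrow> 'p padic_seq \<Rightarrow> bool" where
  "padic_rel X Y \<longleftrightarrow> (\<lambda>n. padic_abs CARD('p) (padic_seq_nth X n - padic_seq_nth Y n)) \<longlonglongrightarrow> 0"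

lemma padic_rel_iff_norm: "padic_rel X Y \<longleftrightarrow> padic_seq_norm (X - Y) = 0"
  using padic_seq_norm_eqI[of "X - Y" 0] tendsto_padic_seq_norm[of "X - Y"]
  by (auto simp: padic_rel_def)

lemma padic_rel_refl: "padic_rel X X"
  by (simp add: padic_rel_iff_norm)

lemma padic_rel_sym: "padic_rel X Y \<Longrightarrow> padic_rel Y X"
  by (simp add: padic_rel_iff_norm padic_seq_norm_diff_commute)

lemma padic_rel_trans: "padic_rel X Y \<Longrightarrow> padic_rel Y Z \<Longrightarrow> padic_rel X Z"
  using padic_seq_norm_add[of "X - Y" "Y - Z"] padic_seq_norm_nonneg[of "X - Z"]
  by (simp add: padic_rel_iff_norm)

lemma padic_rel_add: "padic_rel X X' \<Longrightarrow> padic_rel Y Y' \<Longrightarrow> padic_rel (X + Y) (X' + Y')"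
  using padic_seq_norm_add[of "X - X'" "Y - Y'"] padic_seq_norm_nonneg[of "X + Y - (X' + Y')"]
  by (simp add: padic_rel_iff_norm algebra_simps)

lemma padic_rel_minus: "padic_rel X X' \<Longrightarrow> padic_rel (- X) (- X')"
  using padic_seq_norm_minus[of "X - X'"] by (simp add: padic_rel_iff_norm)

lemma padic_rel_mult: "padic_rel X X' \<Longrightarrow> padic_rel Y Y' \<Longrightarrow> padic_rel (X * Y) (X' * Y')"
  using padic_seq_norm_add[of "(X - X') * Y" "X' * (Y - Y')"]
    padic_seq_norm_nonneg[of "X * Y - (X' * Y')"]
  by (simp add: padic_rel_iff_norm padic_seq_norm_mult) (simp add: algebra_simps order_antisym)

quotient_type 'p padic = "'p::prime_card padic_seq" / padic_rel
  by (intro equivpI reflpI sympI transpI)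
     (blast intro: padic_rel_refl padic_rel_sym padic_rel_trans)+

text \<open>\<open>padic_norm\<close> is the absolute value of $\mathbb{Q}_p$ extending \<open>padic_abs\<close>.\<close>

lift_definition padic_norm :: "'p::prime_card padic \<Rightarrow> real" is padic_seq_norm
  by (simp add: padic_rel_iff_norm padic_seq_norm_diff_eq_0_imp)

instantiation padic :: (prime_card) comm_ring_1
begin

lift_definition zero_padic :: "'a padic" is 0 .
lift_definition one_padic :: "'a padic" is 1 .
lift_definition plus_padic :: "'a padic \<Rightarrow> 'a padic \<Rightarrow> 'a padic" is "(+)" by (rule padic_rel_add)
lift_definition uminus_padic :: "'a padic \<Rightarrow> 'a padic" is "uminus" by (rule padic_rel_minus)
lift_definition minus_padic :: "'a padic \<Rightarrow> 'a padic \<Rightarrow> 'a padic" is "(-)"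
  using padic_rel_add[OF _ padic_rel_minus] by (metis diff_conv_add_uminus)
lift_definition times_padic :: "'a padic \<Rightarrow> 'a padic \<Rightarrow> 'a padic" is "(*)" by (rule padic_rel_mult)

instance
proof
  show "(0 :: 'a padic) \<noteq> 1" by transfer (simp add: padic_rel_iff_norm)
qed (transfer; simp add: padic_rel_refl algebra_simps)+

end

lemma padic_norm_eq_0_iff [simp]: "padic_norm x = 0 \<longleftrightarrow> x = 0"
  by transfer (simp add: padic_rel_iff_norm)

lemma padic_norm_0 [simp]: "padic_norm 0 = 0"
  by simp

lemma padic_norm_nonneg [simp]: "padic_norm x \<ge> 0"
  by transfer simp

lemma padic_norm_minus [simp]: "padic_norm (- x) = padic_norm x"
  by transfer simp

lemma padic_norm_mult: "padic_norm (x * y) = padic_norm x * padic_norm y"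
  by transfer (simp add: padic_seq_norm_mult)

lemma padic_norm_add_le_max: "padic_norm (x + y) \<le> max (padic_norm x) (padic_norm y)"
  by transfer (rule padic_seq_norm_add)

lemma padic_inverse_exists: "x \<noteq> 0 \<Longrightarrow> \<exists>y. y * x = (1 :: 'p::prime_card padic)"
  by transfer (simp add: padic_rel_iff_norm padic_seq_inverse_exists)

instantiation padic :: (prime_card) field
begin

definition inverse_padic :: "'a padic \<Rightarrow> 'a padic" where
  "inverse_padic x = (if x = 0 then 0 else (THE y. y * x = 1))"

definition divide_padic :: "'a padic \<Rightarrow> 'a padic \<Rightarrow> 'a padic" where
  "divide_padic x y = x * inverse y"

instance
proof
  fix x y :: "'a padic"
  show "inverse x * x = 1" if x: "x \<noteq> 0"
  proof -
    obtain y where y: "y * x = 1" using padic_inverse_exists[OF x] by blast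
    have "(THE y. y * x = 1) = y"
    proof (rule the_equality[where P = "\<lambda>y. y * x = 1"])
      fix z assume z: "z * x = 1"
      have "z = (y * x) * z" using y by simp
      also have "\<dots> = y * (z * x)" by (simp add: mult_ac)
      finally show "z = y" using z by simp
    qed (rule y)
    thus ?thesis using x y by (simp add: inverse_padic_def)
  qed
qed (simp_all add: divide_padic_def inverse_padic_def)

end

lemma padic_norm_of_int:
  "padic_norm (of_int k :: 'p::prime_card padic) = padic_abs CARD('p) (of_int k)"
proof -
  have seq: "padic_seq_nth (of_int k :: 'p padic_seq) n = of_int k" for n
  proof (cases k rule: int_cases2)
    case (nonneg m)
    have "padic_seq_nth (of_nat m :: 'p padic_seq) n = of_nat m" by (induction m) auto
    thus ?thesis using nonneg by simp
  next
    case (nonpos m)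
    have "padic_seq_nth (of_nat m :: 'p padic_seq) n = of_nat m" by (induction m) auto
    thus ?thesis using nonpos by simp
  qed
  have "padic_seq_norm (of_int k :: 'p padic_seq) = padic_abs CARD('p) (of_int k)"
    by (rule padic_seq_norm_eqI) (simp add: seq)
  moreover have "padic_norm (of_int k :: 'p padic) = padic_seq_norm (of_int k :: 'p padic_seq)"
  proof -
    have "of_nat m = abs_padic (of_nat m :: 'p padic_seq)" for m
      by (induction m) (simp_all add: zero_padic.abs_eq one_padic.abs_eq plus_padic.abs_eq)
    hence "of_int k = abs_padic (of_int k :: 'p padic_seq)"
      by (cases k rule: int_cases2) (simp_all add: uminus_padic.abs_eq)
    thus ?thesis by (simp add: padic_norm.abs_eq)
  qed
  ultimately show ?thesis by simp
qed

instance padic :: (prime_card) field_char_0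
proof
  show "inj (of_nat :: nat \<Rightarrow> 'a padic)"
  proof (rule injI)
    fix m n :: nat assume "(of_nat m :: 'a padic) = of_nat n"
    hence "(of_int (int m - int n) :: 'a padic) = 0" by simp
    hence "padic_abs CARD('a) (of_int (int m - int n)) = 0"
      using padic_norm_of_int[of "int m - int n", where 'p = 'a] by simp
    hence "(of_int (int m - int n) :: rat) = 0"
      using padic_abs_eq_0_iff[OF prime_card] by blast
    thus "m = n" by (simp only: of_int_eq_0_iff)
  qed
qed

lemma padic_norm_of_rat: "padic_norm (of_rat r :: 'p::prime_card padic) = padic_abs CARD('p) r"
proof -
  obtain a b where r: "r = of_int a / of_int b" "b \<noteq> 0" by (rule rat_as_fraction)
  have "of_rat r * of_int b = (of_int a :: 'p padic)" using r by (simp add: of_rat_divide)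
  hence "padic_norm (of_rat r :: 'p padic) * padic_abs CARD('p) (of_int b)
       = padic_abs CARD('p) (of_int a)"
    by (metis padic_norm_mult padic_norm_of_int)
  moreover have "padic_abs CARD('p) r * padic_abs CARD('p) (of_int b) = padic_abs CARD('p) (of_int a)"
    using r by (simp flip: padic_abs_mult[OF prime_card])
  moreover have "padic_abs CARD('p) (of_int b) \<noteq> 0"
    using r(2) padic_abs_eq_0_iff[OF prime_card] by (metis of_int_eq_0_iff)
  ultimately show ?thesis by (metis mult_right_cancel)
qed

instantiation padic :: (prime_card) metric_space
begin

definition dist_padic :: "'a padic \<Rightarrow> 'a padic \<Rightarrow> real" where
  "dist_padic x y = padic_norm (x - y)"

definition uniformity_padic :: "('a padic \<times> 'a padic) filter" where
  "uniformity_padic = (INF e\<in>{0<..}. principal {(x, y). dist x y < e})"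

definition open_padic :: "'a padic set \<Rightarrow> bool" where
  "open_padic U \<longleftrightarrow> (\<forall>x\<in>U. eventually (\<lambda>(x', y). x' = x \<longrightarrow> y \<in> U) uniformity)"

instance
proof
  fix x y z :: "'a padic"
  show "dist x y = 0 \<longleftrightarrow> x = y" by (simp add: dist_padic_def)
  show "dist x y \<le> dist x z + dist y z"
  proof -
    have "padic_norm (x - y) \<le> max (padic_norm (x - z)) (padic_norm (y - z))"
      using padic_norm_add_le_max[of "x - z" "z - y"] padic_norm_minus[of "y - z"] by simp
    thus ?thesis
      using padic_norm_nonneg[of "x - z"] padic_norm_nonneg[of "y - z"]
      unfolding dist_padic_def by linarith
  qed
qed (simp_all add: uniformity_padic_def open_padic_def)

end


section \<open>Browkin's function and the p-adic Jacobi--Perron algorithm\<close>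

definition balanced_expansion :: "'p::prime_card padic \<Rightarrow> int \<Rightarrow> (int \<Rightarrow> int) \<Rightarrow> bool" where
  "balanced_expansion \<alpha> k x \<longleftrightarrow>
     (\<forall>j. real_of_int (x j) \<in> {- (real CARD('p) / 2) <..< real CARD('p) / 2}) \<and>
     (\<lambda>i. of_int (x (k + int i)) * of_nat CARD('p) powi (k + int i)) sums \<alpha>"

definition browkin_s :: "'p::prime_card padic \<Rightarrow> rat" where
  "browkin_s \<alpha> = (THE r. \<exists>k x. balanced_expansion \<alpha> k x \<and>
                              r = (\<Sum>j=k..0. of_int (x j) * of_nat CARD('p) powi j))"

text \<open>Every $p$-adic number has a balanced expansion ($p$ odd), and all its balanced expansions give the
  same value of \<open>browkin_s\<close>.\<close>

lemma of_rat_padic_seq: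
  assumes "\<And>n. padic_seq_nth (R :: 'p::prime_card padic_seq) n = r"
  shows "abs_padic R = of_rat r"
proof -
  obtain a b where r: "r = of_int a / of_int b" "b \<noteq> 0" by (rule rat_as_fraction)
  have i: "of_int k = abs_padic (of_int k :: 'p padic_seq)" for k
  proof -
    have "of_nat m = abs_padic (of_nat m :: 'p padic_seq)" for m
      by (induction m) (simp_all add: zero_padic.abs_eq one_padic.abs_eq plus_padic.abs_eq)
    thus ?thesis by (cases k rule: int_cases2) (simp_all add: uminus_padic.abs_eq)
  qed
  have nth: "padic_seq_nth (of_int k :: 'p padic_seq) n = of_int k" for k n
  proof -
    have "padic_seq_nth (of_nat m :: 'p padic_seq) n = of_nat m" for m by (induction m) auto
    thus ?thesis by (cases k rule: int_cases2) simp_all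
  qed
  have "R * of_int b = of_int a"
  proof -
    have "padic_seq_nth (R * of_int b) = padic_seq_nth (of_int a :: 'p padic_seq)"
      using r by (simp add: fun_eq_iff nth assms)
    thus ?thesis by (metis Rep_padic_seq_inject padic_seq_nth.rep_eq ext)
  qed
  hence "abs_padic R * of_int b = of_int a" by (metis i times_padic.abs_eq)
  moreover have "of_rat r * of_int b = (of_int a :: 'p padic)" using r by (simp add: of_rat_divide)
  ultimately show ?thesis using r(2) by (metis mult_right_cancel of_int_eq_0_iff)
qed

lemma of_rat_dense_padic:
  fixes \<alpha> :: "'p::prime_card padic"
  assumes e: "e > 0"
  shows "\<exists>r. padic_norm (\<alpha> - of_rat r) < e"
proof -
  define X where "X = rep_padic \<alpha>"
  have X: "\<alpha> = abs_padic X" by (simp add: X_def Quotient_abs_rep[OF Quotient_padic])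
  have "e / 2 > 0" using e by simp
  then obtain N where N: "\<And>m n. m \<ge> N \<Longrightarrow> n \<ge> N \<Longrightarrow>
      padic_abs CARD('p) (padic_seq_nth X m - padic_seq_nth X n) < e / 2"
    using padic_Cauchy_nth[of X] unfolding padic_Cauchy_def by meson
  obtain R :: "'p padic_seq" where R: "\<And>n. padic_seq_nth R n = padic_seq_nth X N"
    by (metis Abs_padic_seq_inverse mem_Collect_eq padic_seq_nth.rep_eq padic_Cauchy_const)
  have "padic_seq_norm (X - R) \<le> e / 2"
    by (rule LIMSEQ_le_const2[OF tendsto_padic_seq_norm])
       (use N R in \<open>auto intro!: exI[of _ N] less_imp_le\<close>)
  hence "padic_norm (\<alpha> - of_rat (padic_seq_nth X N)) \<le> e / 2"
    by (simp add: X minus_padic.abs_eq padic_norm.abs_eq flip: of_rat_padic_seq[OF R])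
  thus ?thesis using e by (intro exI[of _ "padic_seq_nth X N"]) simp
qed

lemma padic_abs_of_int_le_1: "prime p \<Longrightarrow> padic_abs p (of_int a) \<le> 1"
proof -
  assume p: "prime p"
  have "real p \<ge> 1" using prime_gt_0_nat[OF p] by simp
  hence "inverse (real p ^ m) \<le> 1" for m by (simp add: inverse_le_1_iff)
  thus ?thesis using padic_ord_divide[OF p, of a 1] by (simp add: padic_abs_def power_int_minus)
qed

lemma padic_abs_of_int_lt_1_iff:
  assumes p: "prime p" shows "padic_abs p (of_int a) < 1 \<longleftrightarrow> int p dvd a"
proof (cases "a = 0")
  case False
  have p1: "real p > 1" using prime_gt_1_nat[OF p] by simp
  have "padic_abs p (of_int a) = inverse (real p ^ multiplicity (int p) a)"
    using False padic_ord_divide[OF p, of a 1] by (simp add: padic_abs_def power_int_minus)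
  moreover have "inverse (real p ^ m) < 1 \<longleftrightarrow> m > 0" for m
    using p1 by (cases m) (auto simp: inverse_less_1_iff one_less_power simp del: power_Suc)
  moreover have "multiplicity (int p) a > 0 \<longleftrightarrow> int p dvd a"
    using p False by (intro prime_multiplicity_gt_zero_iff) auto
  ultimately show ?thesis by simp
qed auto

lemma padic_norm_p: "padic_norm (of_nat CARD('p) :: 'p::prime_card padic) = 1 / real CARD('p)"
proof -
  have p: "prime CARD('p)" by (rule prime_card)
  have "padic_ord CARD('p) (of_nat CARD('p)) = 1"
    using padic_ord_divide[OF p, of "int CARD('p)" 1] p by simp
  thus ?thesis
    using padic_norm_of_int[of "int CARD('p)", where 'p = 'p] by (simp add: padic_abs_def field_simps)
qed

lemma balanced_digit_exists:
  fixes z :: "'p::prime_card padic"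
  assumes odd: "odd CARD('p)" and z: "padic_norm z \<le> 1"
  shows "\<exists>d::int. \<bar>2 * d\<bar> < int CARD('p) \<and> padic_norm ((z - of_int d) / of_nat CARD('p)) \<le> 1"
proof -
  let ?p = "int CARD('p)"
  have p: "prime CARD('p)" by (rule prime_card)
  have p0: "real CARD('p) > 0" using prime_gt_0_nat[OF p] by simp
  obtain r where r: "padic_norm (z - of_rat r) < 1 / CARD('p)"
    using of_rat_dense_padic[of "1 / CARD('p)" z] p0 by auto
  have p1: "1 / real CARD('p) \<le> 1" using prime_gt_1_nat[OF p] by simp
  have "padic_norm (of_rat r :: 'p padic) \<le> 1"
    using padic_norm_add_le_max[of "of_rat r - z" z] padic_norm_minus[of "z - of_rat r"] r z p1
    unfolding minus_diff_eq diff_add_cancel by linarith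
  hence r1: "padic_abs CARD('p) r \<le> 1" by (simp add: padic_norm_of_rat)
  obtain a b where q: "quotient_of r = (a, b)" by (cases "quotient_of r")
  have b: "b > 0" "coprime a b" "r = of_int a / of_int b"
    using quotient_of_denom_pos[OF q] quotient_of_coprime[OF q] quotient_of_div[OF q] by auto
  have rb: "padic_abs CARD('p) r * padic_abs CARD('p) (of_int b) = padic_abs CARD('p) (of_int a)"
    using b by (simp flip: padic_abs_mult[OF p])
  have nd: "\<not> ?p dvd b"
  proof
    assume db: "?p dvd b"
    hence "padic_abs CARD('p) (of_int b) < 1" using padic_abs_of_int_lt_1_iff[OF p] by blast
    hence "padic_abs CARD('p) (of_int a) < 1"
      using rb r1 mult_left_le_one_le[of "padic_abs CARD('p) (of_int b)" "padic_abs CARD('p) r"]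
      by simp
    hence "?p dvd a" using padic_abs_of_int_lt_1_iff[OF p] by blast
    with db b(2) have "is_unit ?p" by (meson coprime_common_divisor)
    thus False using prime_gt_1_nat[OF p] by simp
  qed
  have "\<not> padic_abs CARD('p) (of_int b) < 1" using nd padic_abs_of_int_lt_1_iff[OF p] by blast
  hence b1: "padic_abs CARD('p) (of_int b) = 1"
    using padic_abs_of_int_le_1[OF p, of b] by linarith
  have "coprime ?p b" using nd p by (intro prime_imp_coprime) auto
  then obtain u v where uv: "u * ?p + v * b = 1" using bezout_int[of ?p b] by auto
  define m where "m = (v * a) mod ?p"
  define d where "d = (if 2 * m < ?p then m else m - ?p)"
  have m: "0 \<le> m" "m < ?p" using prime_gt_0_nat[OF p] by (simp_all add: m_def)
  have d: "\<bar>2 * d\<bar> < ?p"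
  proof -
    have "2 * m \<noteq> ?p" using odd by (metis dvd_triv_left even_of_nat)
    thus ?thesis using m by (auto simp: d_def)
  qed
  have "?p dvd v * a - m" by (simp add: m_def)
  moreover have "?p dvd m - d" by (simp add: d_def)
  ultimately have "?p dvd (v * a - m) + (m - d)" by (rule dvd_add)
  hence "?p dvd v * a - d" by simp
  hence "?p dvd b * (v * a - d) + ?p * (u * a)" by simp
  also have "b * (v * a - d) + ?p * (u * a) = a * (u * ?p + v * b) - b * d"
    by (simp add: algebra_simps)
  finally have "?p dvd a - b * d" by (simp add: uv)
  then obtain t where t: "a - b * d = ?p * t" by blast
  have "(r - of_int d) * of_int b = of_nat CARD('p) * of_int t"
  proof -
    have "(r - of_int d) * of_int b = of_int (a - b * d)" using b by (simp add: field_simps)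
    thus ?thesis unfolding t by simp
  qed
  hence "padic_abs CARD('p) (r - of_int d) = padic_abs CARD('p) (of_nat CARD('p)) * padic_abs CARD('p) (of_int t)"
    using b1 by (metis padic_abs_mult[OF p] mult.right_neutral)
  also have "padic_abs CARD('p) (of_nat CARD('p)) = 1 / CARD('p)"
    using padic_norm_p[where 'p = 'p] padic_norm_of_rat[of "of_nat CARD('p)", where 'p = 'p] by simp
  also have "1 / CARD('p) * padic_abs CARD('p) (of_int t) \<le> 1 / CARD('p)"
    using padic_abs_of_int_le_1[OF p, of t] p0 by (simp add: divide_right_mono)
  finally have "padic_norm (of_rat (r - of_int d) :: 'p padic) \<le> 1 / CARD('p)"
    by (simp only: padic_norm_of_rat)
  hence "padic_norm (z - of_int d) \<le> 1 / CARD('p)"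
    using padic_norm_add_le_max[of "z - of_rat r" "of_rat (r - of_int d)"] r
    by (simp add: of_rat_diff)
  moreover have "padic_norm ((z - of_int d) / of_nat CARD('p)) * (1 / CARD('p)) = padic_norm (z - of_int d)"
    by (subst padic_norm_p[symmetric], subst padic_norm_mult[symmetric]) simp
  ultimately have "padic_norm ((z - of_int d) / of_nat CARD('p)) * (1 / CARD('p)) \<le> 1 * (1 / CARD('p))"
    by simp
  hence "padic_norm ((z - of_int d) / of_nat CARD('p)) \<le> 1"
    using p0 by (subst (asm) mult_le_cancel_right_pos) simp_all
  with d show ?thesis by blast
qed

lemma padic_norm_powi: "padic_norm (x powi k) = padic_norm x powi k"
proof -
  have one: "padic_norm (1 :: 'a padic) = 1"
    by transfer simp
  have pow: "padic_norm (y ^ n) = padic_norm y ^ n" for y :: "'a padic" and n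
    by (induction n) (simp_all add: one padic_norm_mult)
  have inv: "padic_norm (inverse y) = inverse (padic_norm y)" for y :: "'a padic"
  proof (cases "y = 0")
    case False
    have "padic_norm (inverse y) * padic_norm y = 1"
      using False by (simp flip: padic_norm_mult add: one)
    thus ?thesis by (metis inverse_unique mult.commute)
  qed simp
  show ?thesis by (simp add: power_int_def pow inv)
qed

lemma balanced_expansion_exists:
  fixes \<alpha> :: "'p::prime_card padic"
  assumes odd: "odd CARD('p)"
  shows "\<exists>k x. balanced_expansion \<alpha> k x"
proof -
  let ?P = "of_nat CARD('p) :: 'p padic"
  have p: "prime CARD('p)" by (rule prime_card)
  have p1: "real CARD('p) > 1" using prime_gt_1_nat[OF p] by simp
  have P0: "?P \<noteq> 0" by simp
  obtain N where N: "padic_norm \<alpha> < real CARD('p) ^ N" using real_arch_pow[OF p1] by blast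
  define k where "k = - int N"
  define z0 where "z0 = \<alpha> * ?P ^ N"
  have "padic_norm z0 = padic_norm \<alpha> / real CARD('p) ^ N"
    using padic_norm_powi[of ?P "int N"]
    by (simp add: z0_def padic_norm_mult padic_norm_p power_one_over divide_inverse power_inverse)
  hence z0: "padic_norm z0 \<le> 1" using N p1 by simp
  have "\<exists>f. \<forall>z. padic_norm z \<le> 1 \<longrightarrow> \<bar>2 * f z\<bar> < int CARD('p) \<and> padic_norm ((z - of_int (f z)) / ?P) \<le> 1"
    using balanced_digit_exists[OF odd] by (intro choice) blast
  then obtain f where f: "\<And>z. padic_norm z \<le> 1 \<Longrightarrow> \<bar>2 * f z\<bar> < int CARD('p)"
      "\<And>z. padic_norm z \<le> 1 \<Longrightarrow> padic_norm ((z - of_int (f z)) / ?P) \<le> 1" by blast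
  define z where "z = rec_nat z0 (\<lambda>_ y. (y - of_int (f y)) / ?P)"
  have z_simps: "z 0 = z0" "z (Suc n) = (z n - of_int (f (z n))) / ?P" for n
    by (simp_all add: z_def)
  have zn: "padic_norm (z n) \<le> 1" for n
    by (induction n) (simp_all add: z_simps z0 f)
  define x where "x j = (if j < k then 0 else f (z (nat (j - k))))" for j
  have xk: "x (k + int i) = f (z i)" for i by (simp add: x_def)
  have dig: "\<bar>2 * x j\<bar> < int CARD('p)" for j
    using f(1)[OF zn] p1 by (simp add: x_def)
  have part: "\<alpha> - (\<Sum>i<n. of_int (x (k + int i)) * ?P powi (k + int i)) = ?P powi (k + int n) * z n" for n
  proof (induction n)
    case 0
    show ?case using P0 by (simp add: z_simps z0_def k_def power_int_minus field_simps)
  next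
    case (Suc n)
    have "z n = ?P * z (Suc n) + of_int (x (k + int n))"
      using P0 by (simp add: z_simps xk)
    with Suc show ?case using P0
      by (simp add: power_int_add algebra_simps)
  qed
  have "(\<lambda>n. \<Sum>i<n. of_int (x (k + int i)) * ?P powi (k + int i)) \<longlonglongrightarrow> \<alpha>"
  proof (rule tendsto_dist_iff[THEN iffD2], rule tendsto_sandwich[OF _ _ tendsto_const[of 0]])
    show "\<forall>\<^sub>F n in sequentially. dist (\<Sum>i<n. of_int (x (k + int i)) * ?P powi (k + int i)) \<alpha>
        \<le> (1 / real CARD('p)) powi k * (1 / real CARD('p)) ^ n"
    proof (intro always_eventually allI)
      fix n
      have "dist (\<Sum>i<n. of_int (x (k + int i)) * ?P powi (k + int i)) \<alpha> = padic_norm (?P powi (k + int n) * z n)"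
        by (subst dist_commute) (simp only: dist_padic_def part)
      also have "\<dots> = (1 / real CARD('p)) powi (k + int n) * padic_norm (z n)"
        by (simp add: padic_norm_mult padic_norm_powi padic_norm_p)
      also have "\<dots> \<le> (1 / real CARD('p)) powi (k + int n) * 1"
        using zn p1 by (intro mult_left_mono) auto
      also have "\<dots> = (1 / real CARD('p)) powi k * (1 / real CARD('p)) ^ n"
        using p1 by (simp add: power_int_add)
      finally show "dist (\<Sum>i<n. of_int (x (k + int i)) * ?P powi (k + int i)) \<alpha>
        \<le> (1 / real CARD('p)) powi k * (1 / real CARD('p)) ^ n" .
    qed
    show "(\<lambda>n. (1 / real CARD('p)) powi k * (1 / real CARD('p)) ^ n) \<longlonglongrightarrow> 0"
      using p1 by (intro tendsto_mult_right_zero LIMSEQ_power_zero) simp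
  qed auto
  moreover have "real_of_int (x j) \<in> {- (real CARD('p) / 2) <..< real CARD('p) / 2}" for j
  proof -
    have "real_of_int \<bar>2 * x j\<bar> < real_of_int (int CARD('p))" using dig by (simp only: of_int_less_iff)
    thus ?thesis by auto
  qed
  ultimately have "balanced_expansion \<alpha> k x" by (simp add: balanced_expansion_def sums_def)
  thus ?thesis by blast
qed

lemma balanced_expansion_head:
  fixes \<alpha> :: "'p::prime_card padic"
  assumes odd: "odd CARD('p)" and ex: "balanced_expansion \<alpha> k x"
  defines "r \<equiv> (\<Sum>j=k..0. of_int (x j) * of_nat CARD('p) powi j :: rat)"
  shows "\<exists>m c. r = of_int c / of_nat CARD('p) ^ m"
    and "\<bar>r\<bar> < of_nat CARD('p) / 2"
    and "padic_norm (\<alpha> - of_rat r) < 1"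
proof -
  let ?P = "of_nat CARD('p) :: 'p padic" and ?q = "of_nat CARD('p) :: rat"
  have p: "prime CARD('p)" by (rule prime_card)
  have p1: "real CARD('p) > 1" using prime_gt_1_nat[OF p] by simp
  have q1: "?q > 1" using prime_gt_1_nat[OF p] by simp
  have dig: "\<bar>2 * x j\<bar> \<le> int CARD('p) - 1" for j
  proof -
    have "real_of_int \<bar>2 * x j\<bar> < real_of_int (int CARD('p))"
      using ex unfolding balanced_expansion_def by (auto simp: abs_less_iff) (smt (verit) field_sum_of_halves)+
    thus ?thesis by linarith
  qed
  show "\<exists>m c. r = of_int c / ?q ^ m"
  proof (intro exI)
    have "r * ?q ^ nat (- k) = of_int (\<Sum>j=k..0. x j * int CARD('p) ^ nat (j + (- k)))"
      unfolding r_def sum_distrib_right of_int_sum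
    proof (rule sum.cong[OF refl])
      fix j assume j: "j \<in> {k..0}"
      have "?q powi j * ?q ^ nat (- k) = ?q powi (j + (- k))"
        using j q1 by (subst power_int_add) (auto simp: power_int_def)
      also have "\<dots> = ?q ^ nat (j + (- k))" using j by (simp add: power_int_def)
      finally show "of_int (x j) * ?q powi j * ?q ^ nat (- k)
          = of_int (x j * int CARD('p) ^ nat (j + (- k)))"
        by (simp add: mult.assoc)
    qed
    thus "r = of_int (\<Sum>j=k..0. x j * int CARD('p) ^ nat (j + (- k))) / ?q ^ nat (- k)"
      using q1 by (simp add: field_simps)
  qed
  show "\<bar>r\<bar> < ?q / 2"
  proof -
    have geo: "(\<Sum>j=l..0. (?q - 1) * ?q powi j) < ?q" for l :: int
    proof (cases "l \<le> 0")
      case True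
      then obtain n where n: "l = - int n" by (metis minus_minus neg_0_le_iff_le nonneg_int_cases)
      have "(\<Sum>j=- int n..0. (?q - 1) * ?q powi j) = ?q - ?q powi (- int n)"
      proof (induction n)
        case (Suc n)
        have "{- int (Suc n)..0} = insert (- int (Suc n)) {- int n..0}" by auto
        hence "(\<Sum>j=- int (Suc n)..0. (?q - 1) * ?q powi j)
            = (?q - 1) * ?q powi (- int (Suc n)) + (?q - ?q powi (- int n))"
          using Suc by simp
        also have "?q powi (- int n) = ?q * ?q powi (- int (Suc n))"
          using q1 power_int_add[of ?q 1 "- int (Suc n)"] by simp
        finally show ?case by (simp add: algebra_simps)
      qed simp
      thus ?thesis using q1 by (simp add: n)
    qed (use q1 in simp)
    have "\<bar>2 * r\<bar> \<le> (\<Sum>j=k..0. \<bar>2 * (of_int (x j) * ?q powi j)\<bar>)"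
      unfolding r_def sum_distrib_left by (rule sum_abs)
    also have "\<dots> \<le> (\<Sum>j=k..0. (?q - 1) * ?q powi j)"
    proof (rule sum_mono)
      fix j
      have "of_int \<bar>2 * x j\<bar> \<le> (of_int (int CARD('p) - 1) :: rat)" using dig by (simp only: of_int_le_iff)
      hence "of_int \<bar>2 * x j\<bar> * ?q powi j \<le> (?q - 1) * ?q powi j"
        using q1 by (intro mult_right_mono) auto
      thus "\<bar>2 * (of_int (x j) * ?q powi j)\<bar> \<le> (?q - 1) * ?q powi j"
        using q1 by (simp add: abs_mult mult.assoc)
    qed
    also have "\<dots> < ?q" by (rule geo)
    finally show ?thesis by simp
  qed
  define S where "S n = (\<Sum>i<n. of_int (x (k + int i)) * ?P powi (k + int i))" for n
  have lim: "S \<longlonglongrightarrow> \<alpha>" using ex by (simp add: balanced_expansion_def sums_def S_def[abs_def])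
  have tail: "padic_norm (S n - of_rat r) \<le> 1 / real CARD('p)" if n: "int n > - k" for n
  proof -
    have S: "S n = (\<Sum>j\<in>{k..<k + int n}. of_int (x j) * ?P powi j)"
      unfolding S_def
      by (rule sum.reindex_bij_witness[of _ "\<lambda>j. nat (j - k)" "\<lambda>i. k + int i"]) auto
    have R: "of_rat r = (\<Sum>j=k..0. of_int (x j) * ?P powi j)"
      unfolding r_def of_rat_sum
      by (intro sum.cong refl) (auto simp: of_rat_mult power_int_def of_rat_power of_rat_inverse)
    have diff: "S n - of_rat r = (\<Sum>j\<in>{k..<k + int n} - {k..0}. of_int (x j) * ?P powi j)"
      unfolding S R using n by (subst sum_diff) auto
    have le: "padic_norm (\<Sum>j\<in>A. of_int (x j) * ?P powi j) \<le> 1 / real CARD('p)"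
      if "finite A" "\<And>j. j \<in> A \<Longrightarrow> j \<ge> 1" for A :: "int set"
      using that
    proof (induction A rule: finite_induct)
      case (insert j A)
      have "padic_norm (of_int (x j) * ?P powi j) \<le> 1 * (1 / real CARD('p)) powi j"
        using padic_abs_of_int_le_1[OF p, of "x j"] p1
        by (simp add: padic_norm_mult padic_norm_powi padic_norm_p padic_norm_of_int mult_left_le_one_le)
      also have "\<dots> \<le> (1 / real CARD('p)) powi 1"
        using insert.prems p1 by (simp del: power_int_1_right) (intro power_int_decreasing, auto)
      finally show ?case
        using insert padic_norm_add_le_max[of "of_int (x j) * ?P powi j" "\<Sum>j\<in>A. of_int (x j) * ?P powi j"]
        by simp
    qed simp
    show ?thesis unfolding diff by (rule le) auto
  qed
  obtain n0 where n0: "\<And>n. n \<ge> n0 \<Longrightarrow> dist (S n) \<alpha> < 1"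
    using lim unfolding lim_sequentially by (metis zero_less_one)
  define n where "n = max n0 (nat (1 - k))"
  have 1: "padic_norm (\<alpha> - S n) < 1"
    using n0[of n] by (simp add: n_def dist_commute flip: dist_padic_def)
  have "padic_norm (S n - of_rat r) \<le> 1 / real CARD('p)" by (rule tail) (simp add: n_def)
  also have "\<dots> < 1" using p1 by simp
  finally show "padic_norm (\<alpha> - of_rat r) < 1"
    using padic_norm_add_le_max[of "\<alpha> - S n" "S n - of_rat r"] 1 by simp
qed

lemma balanced_head_unique:
  fixes \<alpha> :: "'p::prime_card padic"
  assumes "r = of_int c / of_nat CARD('p) ^ m" "\<bar>r\<bar> < of_nat CARD('p) / 2" "padic_norm (\<alpha> - of_rat r) < 1"
    and "r' = of_int c' / of_nat CARD('p) ^ m'" "\<bar>r'\<bar> < of_nat CARD('p) / 2" "padic_norm (\<alpha> - of_rat r') < 1"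
  shows "r = r'"
proof (rule ccontr)
  assume ne: "r \<noteq> r'"
  let ?q = "of_nat CARD('p) :: rat" and ?p = "int CARD('p)"
  have p: "prime CARD('p)" by (rule prime_card)
  have q1: "?q > 1" using prime_gt_1_nat[OF p] by simp
  define e where "e = c * ?p ^ m' - c' * ?p ^ m"
  define M where "M = m + m'"
  have d: "(r - r') * ?q ^ M = of_int e"
    using q1 by (simp add: assms(1,4) e_def M_def field_simps power_add)
  have e0: "e \<noteq> 0" using d ne q1 by auto
  have "padic_norm (of_rat (r - r') :: 'p padic) < 1"
    using padic_norm_add_le_max[of "of_rat r - \<alpha>" "\<alpha> - of_rat r'"] assms(3,6)
      padic_norm_minus[of "\<alpha> - of_rat r"] by (simp add: of_rat_diff)
  hence lt: "padic_abs CARD('p) (r - r') < 1" by (simp add: padic_norm_of_rat)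
  have rr: "r - r' = of_int e / of_int (?p ^ M)" using d q1 by (simp add: field_simps)
  have "padic_ord CARD('p) (r - r') = int (multiplicity ?p e) - int M"
    unfolding rr using padic_ord_divide[OF p e0, of "?p ^ M"] p q1 by simp
  moreover have "padic_ord CARD('p) (r - r') > 0"
  proof (rule ccontr)
    assume "\<not> ?thesis"
    hence "real CARD('p) powi 0 \<le> real CARD('p) powi (- padic_ord CARD('p) (r - r'))"
      using prime_gt_1_nat[OF p] by (intro power_int_increasing) auto
    thus False using lt ne by (simp add: padic_abs_def)
  qed
  ultimately have "Suc M \<le> multiplicity ?p e" by linarith
  hence "?p ^ Suc M dvd e" by (rule multiplicity_dvd')
  then obtain t where t: "e = ?p ^ Suc M * t" by blast
  have "(r - r') * ?q ^ M = (?q * of_int t) * ?q ^ M" using d t by simp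
  hence "r - r' = ?q * of_int t" using q1 by simp
  moreover have "t \<noteq> 0" using t e0 by auto
  hence "(of_int \<bar>t\<bar> :: rat) \<ge> 1" by simp
  hence "?q * \<bar>of_int t\<bar> \<ge> ?q" using q1 by simp
  ultimately have "\<bar>r - r'\<bar> \<ge> ?q" using q1 by (simp add: abs_mult)
  thus False using assms(2,5) by linarith
qed

lemma browkin_s_eq:
  fixes \<alpha> :: "'p::prime_card padic"
  assumes odd: "odd CARD('p)" and ex: "balanced_expansion \<alpha> k x"
  shows "browkin_s \<alpha> = (\<Sum>j=k..0. of_int (x j) * of_nat CARD('p) powi j)"
  unfolding browkin_s_def
proof (rule the_equality)
  fix r :: rat assume "\<exists>k x. balanced_expansion \<alpha> k x \<and> r = (\<Sum>j=k..0. of_int (x j) * of_nat CARD('p) powi j)"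
  then obtain k' x' where ex': "balanced_expansion \<alpha> k' x'"
    and r: "r = (\<Sum>j=k'..0. of_int (x' j) * of_nat CARD('p) powi j)" by blast
  note h = balanced_expansion_head[OF odd ex] and h' = balanced_expansion_head[OF odd ex', folded r]
  obtain m c where mc: "(\<Sum>j=k..0. of_int (x j) * of_nat CARD('p) powi j) = of_int c / (of_nat CARD('p) :: rat) ^ m"
    using h(1) by (elim exE)
  obtain m' c' where mc': "r = of_int c' / of_nat CARD('p) ^ m'"
    using h'(1) by (elim exE)
  show "r = (\<Sum>j=k..0. of_int (x j) * of_nat CARD('p) powi j)"
    by (rule balanced_head_unique[OF mc' h'(2,3) mc h(2,3)])
qed (use ex in blast)

text \<open>\<open>jacobi_perron_expansion \<alpha> \<beta> a b\<close>: the algorithm applied to $(\alpha, \beta)$ never stops and produces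
  the partial quotients $[(a_0, a_1, \ldots), (b_0, b_1, \ldots)]$; \<open>u\<close> and \<open>v\<close> are the complete
  quotients $\alpha_k$ and $\beta_k$.\<close>

definition jacobi_perron_expansion ::
  "'p::prime_card padic \<Rightarrow> 'p padic \<Rightarrow> (nat \<Rightarrow> rat) \<Rightarrow> (nat \<Rightarrow> rat) \<Rightarrow> bool" where
  "jacobi_perron_expansion \<alpha> \<beta> a b \<longleftrightarrow>
     (\<exists>u v. u 0 = \<alpha> \<and> v 0 = \<beta> \<and>
        (\<forall>k. a k = browkin_s (u k) \<and> b k = browkin_s (v k) \<and>
             v k \<noteq> of_rat (b k) \<and>
             u (Suc k) = 1 / (v k - of_rat (b k)) \<and>
             v (Suc k) = (u k - of_rat (a k)) / (v k - of_rat (b k))))"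

text \<open>Solution of $X_n = a_n X_{n-1} + b_n X_{n-2} + X_{n-3}$ ($n \ge 1$) with
  $X_{-2} = u$, $X_{-1} = v$, $X_0 = w$.\<close>

fun mcf_rec :: "(nat \<Rightarrow> rat) \<Rightarrow> (nat \<Rightarrow> rat) \<Rightarrow> rat \<Rightarrow> rat \<Rightarrow> rat \<Rightarrow> nat \<Rightarrow> rat" where
  "mcf_rec a b u v w 0 = w"
| "mcf_rec a b u v w (Suc 0) = a 1 * w + b 1 * v + u"
| "mcf_rec a b u v w (Suc (Suc 0)) = a 2 * mcf_rec a b u v w 1 + b 2 * w + v"
| "mcf_rec a b u v w (Suc (Suc (Suc n))) =
     a (n + 3) * mcf_rec a b u v w (Suc (Suc n)) + b (n + 3) * mcf_rec a b u v w (Suc n)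
     + mcf_rec a b u v w n"

definition mcf_A :: "(nat \<Rightarrow> rat) \<Rightarrow> (nat \<Rightarrow> rat) \<Rightarrow> nat \<Rightarrow> rat" where
  "mcf_A a b = mcf_rec a b 0 1 (a 0)"

definition mcf_B :: "(nat \<Rightarrow> rat) \<Rightarrow> (nat \<Rightarrow> rat) \<Rightarrow> nat \<Rightarrow> rat" where
  "mcf_B a b = mcf_rec a b 1 0 (b 0)"

definition mcf_C :: "(nat \<Rightarrow> rat) \<Rightarrow> (nat \<Rightarrow> rat) \<Rightarrow> nat \<Rightarrow> rat" where
  "mcf_C a b = mcf_rec a b 0 0 1"

definition convergent_alpha :: "(nat \<Rightarrow> rat) \<Rightarrow> (nat \<Rightarrow> rat) \<Rightarrow> nat \<Rightarrow> rat" where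
  "convergent_alpha a b n = mcf_A a b n / mcf_C a b n"

definition convergent_beta :: "(nat \<Rightarrow> rat) \<Rightarrow> (nat \<Rightarrow> rat) \<Rightarrow> nat \<Rightarrow> rat" where
  "convergent_beta a b n = mcf_B a b n / mcf_C a b n"

definition mcf_k :: "nat \<Rightarrow> (nat \<Rightarrow> rat) \<Rightarrow> nat \<Rightarrow> ereal" where
  "mcf_k p a n = padic_valuation p (1 / a n)"

definition mcf_h :: "nat \<Rightarrow> (nat \<Rightarrow> rat) \<Rightarrow> (nat \<Rightarrow> rat) \<Rightarrow> nat \<Rightarrow> ereal" where
  "mcf_h p a b n = padic_valuation p (b n / a n)"


section \<open>Polynomials in two variables over the rationals\<close>

text \<open>\<open>rat poly poly\<close> stands for $\mathbb{Q}[X][Y] = \mathbb{Q}[X,Y]$: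
  \<open>coeff (coeff F j) i\<close> is the coefficient of $X^i Y^j$. \<open>total_degree\<close> is only meaningful for
  nonzero polynomials.\<close>

definition eval2 :: "rat poly poly \<Rightarrow> 'a::field_char_0 \<Rightarrow> 'a \<Rightarrow> 'a" where
  "eval2 F x y = poly (map_poly (\<lambda>q. poly (map_poly of_rat q) x) F) y"

definition total_degree :: "rat poly poly \<Rightarrow> nat" where
  "total_degree F = Max {i + j |i j. coeff (coeff F j) i \<noteq> 0}"

definition algebraically_dependent :: "'a::field_char_0 \<Rightarrow> 'a \<Rightarrow> bool" where
  "algebraically_dependent x y \<longleftrightarrow> (\<exists>G. G \<noteq> 0 \<and> eval2 G x y = 0)"

end

theory Submission
  imports Defs
begin

text \<open>Write $V_n$ for either of $A_n - \alpha C_n$, $B_n - \beta C_n$. Both satisfy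
  $\alpha_{n+1} V_n + \beta_{n+1} V_{n-1} + V_{n-2} = 0$, and $|C_n|_p = |a_1|_p \cdots |a_n|_p$. The two
  conditions on $k_{n+1}$ and $h_{n+1}$ are exactly what makes $|V_n|_p \, |C_n|_p^{D-1} p^{Dn}$ at most the
  maximum of its two predecessors, hence bounded. As $F(\alpha, \beta) = 0$ and $F$ is Lipschitz on bounded
  sets, $|C_n^D F(Q_n^\alpha, Q_n^\beta)|_p = O(p^{-Dn})$. Up to a constant integer factor
  $C_n^D F(Q_n^\alpha, Q_n^\beta)$ lies in $\mathbb{Z}[1/p]$, where a nonzero $x$ satisfies
  $|x| \, |x|_p \ge 1$; but the partial quotients are less than $p/2$ in absolute value, so the ordinary
  absolute value of $C_n^D F(Q_n^\alpha, Q_n^\beta)$ is only $O((5p/6)^{Dn})$, and it must vanish for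
  large $n$.\<close>

section \<open>The ring Z[1/p]\<close>

definition p_fractions :: "nat \<Rightarrow> rat set" where
  "p_fractions p = {of_int c / of_nat p ^ m |c m. True}"

lemma p_fractionsI: "x = of_int c / of_nat p ^ m \<Longrightarrow> x \<in> p_fractions p"
  by (auto simp: p_fractions_def)

lemma of_int_in_p_fractions [simp]: "of_int c \<in> p_fractions p"
  by (rule p_fractionsI[of _ c p 0]) simp

lemma p_fractions_0_1 [simp]: "0 \<in> p_fractions p" "1 \<in> p_fractions p"
  using of_int_in_p_fractions[of 0 p] of_int_in_p_fractions[of 1 p] by simp_all

lemma p_fractions_mult: "x \<in> p_fractions p \<Longrightarrow> y \<in> p_fractions p \<Longrightarrow> x * y \<in> p_fractions p"
proof -
  assume "x \<in> p_fractions p" "y \<in> p_fractions p"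
  then obtain c m d n where "x = of_int c / of_nat p ^ m" "y = of_int d / of_nat p ^ n"
    by (auto simp: p_fractions_def)
  thus ?thesis by (intro p_fractionsI[of _ "c * d" p "m + n"]) (simp add: power_add)
qed

lemma p_fractions_add:
  assumes "p > 0" "x \<in> p_fractions p" "y \<in> p_fractions p"
  shows "x + y \<in> p_fractions p"
proof -
  obtain c m d n where xy: "x = of_int c / of_nat p ^ m" "y = of_int d / of_nat p ^ n"
    using assms by (auto simp: p_fractions_def)
  have "x + y = of_int (c * int p ^ n + d * int p ^ m) / of_nat p ^ (m + n)"
    using assms(1) unfolding xy by (simp add: power_add field_simps)
  thus ?thesis by (rule p_fractionsI)
qed

lemma p_fractions_power: "x \<in> p_fractions p \<Longrightarrow> x ^ n \<in> p_fractions p"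
  by (induction n) (auto intro: p_fractions_mult)

lemma p_fractions_sum:
  assumes "p > 0" "\<And>i. i \<in> I \<Longrightarrow> f i \<in> p_fractions p"
  shows "sum f I \<in> p_fractions p"
  using assms(2) by (induction I rule: infinite_finite_induct) (auto intro: p_fractions_add[OF assms(1)])

text \<open>For \<open>x = c / p^m\<close> the factor \<open>p^m\<close> cancels between the two
  absolute values, and a nonzero integer \<open>c\<close> is at least as large as the power of
  \<open>p\<close> dividing it. This is what forces an element that is too small at both places to
  vanish.\<close>

lemma p_fractions_product_formula:
  assumes p: "prime p" and x: "x \<in> p_fractions p" "x \<noteq> 0"
  shows "1 \<le> \<bar>real_of_rat x\<bar> * padic_abs p x"
proof -
  obtain c m where cm: "x = of_int c / of_nat p ^ m" using x by (auto simp: p_fractions_def)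
  have c0: "c \<noteq> 0" using x cm by auto
  have p0: "real p > 0" using prime_gt_0_nat[OF p] by simp
  define k where "k = multiplicity (int p) c"
  have "padic_ord p x = int k - int m"
    using padic_ord_divide[OF p c0, of "int p ^ m"] p p0 unfolding cm k_def by simp
  hence abs: "padic_abs p x = real p ^ m / real p ^ k"
    using x(2) p0 by (simp add: padic_abs_def power_int_diff)
  have "int p ^ k dvd c" by (simp add: k_def multiplicity_dvd)
  hence "\<bar>int p ^ k\<bar> \<le> \<bar>c\<bar>" by (rule dvd_imp_le_int[OF c0])
  hence "real_of_int \<bar>int p ^ k\<bar> \<le> real_of_int \<bar>c\<bar>" by (simp only: of_int_le_iff)
  hence "real p ^ k \<le> \<bar>real_of_int c\<bar>" by simp
  moreover have "\<bar>real_of_rat x\<bar> = \<bar>real_of_int c\<bar> / real p ^ m"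
    using p0 by (simp add: cm of_rat_divide of_rat_power)
  ultimately show ?thesis using p0 by (simp add: abs)
qed

section \<open>The p-adic norm\<close>

lemma padic_norm_1 [simp]: "padic_norm 1 = 1"
  using padic_norm_powi[of 1 0] by simp

lemma padic_norm_power: "padic_norm (x ^ n) = padic_norm x ^ n"
  by (induction n) (simp_all add: padic_norm_mult)

lemma padic_norm_divide: "padic_norm (x / y) = padic_norm x / padic_norm y"
proof (cases "y = 0")
  case False
  have "padic_norm (x / y) * padic_norm y = padic_norm x"
    using False by (simp flip: padic_norm_mult)
  thus ?thesis using False by (simp add: field_simps)
qed simp

lemma padic_norm_diff_le_max: "padic_norm (x - y) \<le> max (padic_norm x) (padic_norm y)"
  using padic_norm_add_le_max[of x "- y"] by simp

text \<open>Isosceles triangle principle: the ultrametric inequality is applied to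
  \<open>y = x - (x - y)\<close> and to \<open>x = (x - y) + y\<close>, where the first summand
  cannot attain the norm of \<open>x\<close>.\<close>

lemma padic_norm_eq_if_diff_less:
  assumes "padic_norm (x - y) < padic_norm x"
  shows "padic_norm y = padic_norm x"
  using padic_norm_diff_le_max[of x "x - y"] padic_norm_add_le_max[of "x - y" y] assms by auto

lemma padic_norm_sum_le:
  assumes "c \<ge> 0" "\<And>i. i \<in> I \<Longrightarrow> padic_norm (f i) \<le> c"
  shows "padic_norm (sum f I) \<le> c"
  using assms(2)
proof (induction I rule: infinite_finite_induct)
  case (insert i I)
  hence "padic_norm (f i) \<le> c" "padic_norm (sum f I) \<le> c" by auto
  thus ?case using padic_norm_add_le_max[of "f i" "sum f I"] insert.hyps by simp
qed (use assms(1) in auto)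

text \<open>The ultrametric maximum avoids a factor \<open>n\<close>, and \<open>1 \<le> M\<close>
  lets the exponent \<open>n - 1\<close> of the sharp bound be rounded up to
  \<open>n\<close>.\<close>

lemma padic_norm_power_diff_le:
  assumes "padic_norm x \<le> M" "padic_norm y \<le> M" "1 \<le> M"
  shows "padic_norm (x ^ n - y ^ n) \<le> M ^ n * padic_norm (x - y)"
proof (induction n)
  case (Suc n)
  have "x ^ Suc n - y ^ Suc n = x * (x ^ n - y ^ n) + (x - y) * y ^ n"
    by (simp add: algebra_simps)
  hence "padic_norm (x ^ Suc n - y ^ Suc n)
      \<le> max (padic_norm x * padic_norm (x ^ n - y ^ n)) (padic_norm (x - y) * padic_norm y ^ n)"
    using padic_norm_add_le_max[of "x * (x ^ n - y ^ n)" "(x - y) * y ^ n"]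
    by (simp add: padic_norm_mult padic_norm_power)
  moreover have "padic_norm x * padic_norm (x ^ n - y ^ n) \<le> M * (M ^ n * padic_norm (x - y))"
    using assms Suc by (intro mult_mono) auto
  moreover have "padic_norm (x - y) * padic_norm y ^ n \<le> padic_norm (x - y) * M ^ Suc n"
    using assms power_increasing[of n "Suc n" M]
    by (intro mult_left_mono order_trans[OF power_mono[of "padic_norm y" M n]]) auto
  ultimately show ?case by (simp add: mult_ac)
qed simp

lemma padic_norm_monomial_diff_le:
  assumes "padic_norm x \<le> M" "padic_norm y \<le> M" "padic_norm x' \<le> M" "padic_norm y' \<le> M" "1 \<le> M"
    and "padic_norm (x - x') \<le> e" "padic_norm (y - y') \<le> e"
  shows "padic_norm (x ^ i * y ^ j - x' ^ i * y' ^ j) \<le> M ^ (i + j) * e"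
proof -
  have e: "0 \<le> e" using assms(6) padic_norm_nonneg order_trans by blast
  have pow: "padic_norm z ^ n \<le> M ^ n" if "padic_norm z \<le> M" for z :: "'a padic" and n
    using that by (intro power_mono) auto
  have diff: "padic_norm (z ^ n - z' ^ n) \<le> M ^ n * e"
    if "padic_norm z \<le> M" "padic_norm z' \<le> M" "padic_norm (z - z') \<le> e" for z z' :: "'a padic" and n
    using assms(5) by (intro order_trans[OF padic_norm_power_diff_le[OF that(1,2) assms(5)]]
        mult_left_mono that(3)) auto
  have "x ^ i * y ^ j - x' ^ i * y' ^ j = x ^ i * (y ^ j - y' ^ j) + (x ^ i - x' ^ i) * y' ^ j"
    by (simp add: algebra_simps)
  hence "padic_norm (x ^ i * y ^ j - x' ^ i * y' ^ j)
      \<le> max (padic_norm x ^ i * padic_norm (y ^ j - y' ^ j)) (padic_norm (x ^ i - x' ^ i) * padic_norm y' ^ j)"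
    using padic_norm_add_le_max[of "x ^ i * (y ^ j - y' ^ j)" "(x ^ i - x' ^ i) * y' ^ j"]
    by (simp add: padic_norm_mult padic_norm_power)
  moreover have "padic_norm x ^ i * padic_norm (y ^ j - y' ^ j) \<le> M ^ i * (M ^ j * e)"
    using assms e by (intro mult_mono pow diff) auto
  moreover have "padic_norm (x ^ i - x' ^ i) * padic_norm y' ^ j \<le> (M ^ i * e) * M ^ j"
    using assms e by (intro mult_mono pow diff) auto
  ultimately show ?thesis by (simp add: power_add mult_ac)
qed

section \<open>Polynomials in two variables\<close>

text \<open>The support as a set of exponent pairs turns the nested evaluation into a single finite
  sum, to be estimated term by term.\<close>

definition monomials :: "rat poly poly \<Rightarrow> (nat \<times> nat) set" where
  "monomials F = {(i, j). coeff (coeff F j) i \<noteq> 0}"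

lemma finite_monomials: "finite (monomials F)"
proof -
  have "(i, j) \<in> (\<Union>j\<le>degree F. {..degree (coeff F j)} \<times> {j})" if "(i, j) \<in> monomials F" for i j
  proof -
    have c: "coeff (coeff F j) i \<noteq> 0" using that by (simp add: monomials_def)
    hence "coeff F j \<noteq> 0" by auto
    with c show ?thesis by (auto intro: le_degree)
  qed
  hence "monomials F \<subseteq> (\<Union>j\<le>degree F. {..degree (coeff F j)} \<times> {j})" by auto
  thus ?thesis by (rule finite_subset) auto
qed

lemma monomial_le_total_degree:
  assumes "(i, j) \<in> monomials F" shows "i + j \<le> total_degree F"
proof -
  have "{i + j |i j. coeff (coeff F j) i \<noteq> 0} = (\<lambda>(i, j). i + j) ` monomials F"
    by (auto simp: monomials_def image_iff)
  moreover have "i + j \<in> (\<lambda>(i, j). i + j) ` monomials F"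
    using image_eqI[of "i + j" "\<lambda>(i, j). i + j" "(i, j)", OF _ assms] by simp
  ultimately show ?thesis unfolding total_degree_def using finite_monomials[of F] by simp
qed

text \<open>The sum runs over the support of \<open>q\<close> rather than of
  \<open>map_poly g q\<close>: evaluating the inner polynomials at a point can kill nonzero
  coefficients, so the degree may drop.\<close>

lemma poly_map_poly_eq_sum_support:
  fixes x :: "'a::comm_semiring_1"
  assumes "g 0 = 0"
  shows "poly (map_poly g q) x = (\<Sum>i | coeff q i \<noteq> 0. g (coeff q i) * x ^ i)"
proof -
  have "poly (map_poly g q) x = (\<Sum>i\<le>degree (map_poly g q). g (coeff q i) * x ^ i)"
    by (simp add: poly_altdef coeff_map_poly assms)
  also have "\<dots> = (\<Sum>i\<le>degree q. g (coeff q i) * x ^ i)"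
  proof (rule sum.mono_neutral_left)
    show "\<forall>i\<in>{..degree q} - {..degree (map_poly g q)}. g (coeff q i) * x ^ i = 0"
      using coeff_eq_0[of "map_poly g q"] by (auto simp: coeff_map_poly assms)
  qed (auto simp: map_poly_degree_leq)
  also have "\<dots> = (\<Sum>i | coeff q i \<noteq> 0. g (coeff q i) * x ^ i)"
    by (rule sum.mono_neutral_right) (auto intro: le_degree simp: assms)
  finally show ?thesis .
qed

lemma eval2_eq_sum_monomials:
  "eval2 F x y = (\<Sum>(i, j)\<in>monomials F. of_rat (coeff (coeff F j) i) * (x ^ i * y ^ j))"
proof -
  have fin: "finite {i. coeff q i \<noteq> 0}" for q :: "'c::zero poly"
    using MOST_coeff_eq_0[of q] by (simp add: eventually_cofinite)
  have "eval2 F x y = (\<Sum>j | coeff F j \<noteq> 0. \<Sum>i | coeff (coeff F j) i \<noteq> 0.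
      of_rat (coeff (coeff F j) i) * (x ^ i * y ^ j))"
    unfolding eval2_def
    by (subst poly_map_poly_eq_sum_support)
       (simp_all add: poly_map_poly_eq_sum_support sum_distrib_right mult.assoc)
  also have "\<dots> = (\<Sum>(j, i)\<in>Sigma {j. coeff F j \<noteq> 0} (\<lambda>j. {i. coeff (coeff F j) i \<noteq> 0}).
      of_rat (coeff (coeff F j) i) * (x ^ i * y ^ j))"
    by (rule sum.Sigma) (auto intro: fin)
  also have "\<dots> = (\<Sum>(i, j)\<in>monomials F. of_rat (coeff (coeff F j) i) * (x ^ i * y ^ j))"
    by (rule sum.reindex_bij_witness[of _ prod.swap prod.swap]) (auto simp: monomials_def)
  finally show ?thesis .
qed

lemma of_rat_eval2: "of_rat (eval2 F x y) = eval2 F (of_rat x) (of_rat y)"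
  by (simp add: eval2_eq_sum_monomials of_rat_sum of_rat_mult of_rat_power case_prod_unfold)

text \<open>A nonzero constant has no zeros. Positivity of the degree makes \<open>D - 1\<close> an
  honest subtraction and \<open>(5 / 6) ^ D\<close> less than 1.\<close>

lemma total_degree_pos_if_root:
  assumes "F \<noteq> 0" "eval2 F x y = 0"
  shows "total_degree F > 0"
proof (rule ccontr)
  assume "\<not> total_degree F > 0"
  hence sub: "monomials F \<subseteq> {(0, 0)}" using monomial_le_total_degree[of _ _ F] by force
  obtain j where "coeff F j \<noteq> 0" using assms(1) by (auto simp: poly_eq_iff)
  then obtain i where "coeff (coeff F j) i \<noteq> 0" by (auto simp: poly_eq_iff)
  hence "(i, j) \<in> monomials F" by (simp add: monomials_def)
  with sub have eq: "monomials F = {(0, 0)}" by auto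
  hence "coeff (coeff F 0) 0 \<noteq> 0" by (auto simp: monomials_def)
  thus False using assms(2) by (simp add: eval2_eq_sum_monomials eq)
qed

lemma common_denominator:
  fixes I :: "'i set" and c :: "'i \<Rightarrow> rat"
  assumes "finite I"
  obtains d :: int where "d \<noteq> 0" "\<And>i. i \<in> I \<Longrightarrow> of_int d * c i \<in> \<int>"
  using assms
proof (induction I arbitrary: thesis rule: finite_induct)
  case empty
  show ?case by (rule empty[of 1]) auto
next
  case (insert i I)
  obtain d where d: "d \<noteq> 0" "\<And>i. i \<in> I \<Longrightarrow> of_int d * c i \<in> \<int>" using insert.IH by blast
  obtain r s where rs: "c i = of_int r / of_int s" "s \<noteq> 0" by (rule rat_as_fraction)
  show ?case
  proof (rule insert.prems[of "d * s"])
    fix k assume k: "k \<in> insert i I"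
    show "of_int (d * s) * c k \<in> \<int>"
    proof (cases "k = i")
      case True
      thus ?thesis using rs by simp
    next
      case False
      hence "of_int d * c k \<in> \<int>" using k d(2) by blast
      hence "of_int s * (of_int d * c k) \<in> \<int>" by (rule Ints_mult[OF Ints_of_int])
      thus ?thesis by (simp add: mult_ac)
    qed
  qed (use d rs in auto)
qed

text \<open>The right side contains no division, so it stays in any ring that holds the coefficients
  and \<open>A\<close>, \<open>B\<close>, \<open>C\<close>. The truncated subtraction is harmless
  because \<open>i + j\<close> is at most the total degree.\<close>

lemma eval2_homogenize:
  fixes A B C :: rat
  assumes "C \<noteq> 0"
  shows "C ^ total_degree F * eval2 F (A / C) (B / C) =
    (\<Sum>(i, j)\<in>monomials F. coeff (coeff F j) i * (A ^ i * B ^ j * C ^ (total_degree F - i - j)))"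
  unfolding eval2_eq_sum_monomials sum_distrib_left
proof (rule sum.cong[OF refl], clarify)
  fix i j assume "(i, j) \<in> monomials F"
  then obtain k where k: "total_degree F = i + j + k"
    using monomial_le_total_degree le_Suc_ex by blast
  show "C ^ total_degree F * (of_rat (coeff (coeff F j) i) * ((A / C) ^ i * (B / C) ^ j)) =
      coeff (coeff F j) i * (A ^ i * B ^ j * C ^ (total_degree F - i - j))"
    using assms by (simp add: k power_add power_divide)
qed

text \<open>A Liouville-type bound: a nonzero value of \<open>F\<close> at quotients of elements of
  Z[1/p] cannot be small at both places. \<open>L\<close> is chosen before \<open>A\<close>,
  \<open>B\<close>, \<open>C\<close>, so one constant serves all convergents.\<close>

lemma eval2_product_formula:
  assumes p: "prime p"
  obtains L :: real where "L > 0"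
    "\<And>A B C M. A \<in> p_fractions p \<Longrightarrow> B \<in> p_fractions p \<Longrightarrow> C \<in> p_fractions p \<Longrightarrow> C \<noteq> 0 \<Longrightarrow>
       \<bar>real_of_rat A\<bar> \<le> M \<Longrightarrow> \<bar>real_of_rat B\<bar> \<le> M \<Longrightarrow> \<bar>real_of_rat C\<bar> \<le> M \<Longrightarrow>
       eval2 F (A / C) (B / C) \<noteq> 0 \<Longrightarrow>
       1 \<le> L * M ^ total_degree F * (padic_abs p C ^ total_degree F * padic_abs p (eval2 F (A / C) (B / C)))"
proof -
  let ?D = "total_degree F" and ?c = "\<lambda>i j. coeff (coeff F j) i"
  obtain d where d: "d \<noteq> 0" "\<And>i. i \<in> monomials F \<Longrightarrow> of_int d * (case i of (i, j) \<Rightarrow> ?c i j) \<in> \<int>"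
    using common_denominator[OF finite_monomials[of F], of "\<lambda>(i, j). ?c i j"] by blast
  define L0 where "L0 = (\<Sum>(i, j)\<in>monomials F. \<bar>real_of_rat (of_int d * ?c i j)\<bar>)"
  have L0: "L0 \<ge> 0" unfolding L0_def by (rule sum_nonneg) auto
  show ?thesis
  proof (rule that[of "L0 + 1"])
    fix A B C M
    assume fr: "A \<in> p_fractions p" "B \<in> p_fractions p" "C \<in> p_fractions p"
      and C: "C \<noteq> 0" and M: "\<bar>real_of_rat A\<bar> \<le> M" "\<bar>real_of_rat B\<bar> \<le> M" "\<bar>real_of_rat C\<bar> \<le> M"
      and nz: "eval2 F (A / C) (B / C) \<noteq> 0"
    \<comment> \<open>\<open>d\<close> clears the denominators of the coefficients and
      \<open>C ^ ?D\<close> those of the arguments, which puts \<open>x\<close> in Z[1/p].\<close>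
    define x where "x = of_int d * (C ^ ?D * eval2 F (A / C) (B / C))"
    have M0: "M \<ge> 0" using M(1) by linarith
    have x: "x = (\<Sum>(i, j)\<in>monomials F. (of_int d * ?c i j) * (A ^ i * B ^ j * C ^ (?D - i - j)))"
      unfolding x_def eval2_homogenize[OF C] by (simp add: sum_distrib_left case_prod_unfold mult.assoc)
    have "x \<in> p_fractions p"
      unfolding x
    proof (intro p_fractions_sum prime_gt_0_nat[OF p], clarify)
      fix i j assume "(i, j) \<in> monomials F"
      hence "of_int d * ?c i j \<in> p_fractions p" using d(2)[of "(i, j)"] by (auto elim!: Ints_cases)
      thus "of_int d * ?c i j * (A ^ i * B ^ j * C ^ (?D - i - j)) \<in> p_fractions p"
        by (rule p_fractions_mult) (intro p_fractions_mult p_fractions_power fr)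
    qed
    hence "1 \<le> \<bar>real_of_rat x\<bar> * padic_abs p x"
      by (rule p_fractions_product_formula[OF p]) (use d(1) C nz in \<open>simp add: x_def\<close>)
    also have "\<dots> \<le> ((L0 + 1) * M ^ ?D) * (padic_abs p C ^ ?D * padic_abs p (eval2 F (A / C) (B / C)))"
    proof (rule mult_mono)
      have "\<bar>real_of_rat x\<bar> \<le> (\<Sum>(i, j)\<in>monomials F.
          \<bar>real_of_rat (of_int d * ?c i j)\<bar> * \<bar>real_of_rat (A ^ i * B ^ j * C ^ (?D - i - j))\<bar>)"
        unfolding x of_rat_sum
        by (rule order_trans[OF sum_abs]) (simp add: case_prod_unfold of_rat_mult abs_mult)
      also have "\<dots> \<le> (\<Sum>(i, j)\<in>monomials F. \<bar>real_of_rat (of_int d * ?c i j)\<bar> * M ^ ?D)"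
      proof (rule sum_mono, clarify)
        fix i j assume "(i, j) \<in> monomials F"
        then obtain k where k: "?D = i + j + k"
          using monomial_le_total_degree le_Suc_ex by blast
        have "\<bar>real_of_rat (A ^ i * B ^ j * C ^ k)\<bar> \<le> M ^ i * M ^ j * M ^ k"
          unfolding of_rat_mult of_rat_power abs_mult power_abs
          using M M0 by (intro mult_mono power_mono) auto
        thus "\<bar>real_of_rat (of_int d * ?c i j)\<bar> * \<bar>real_of_rat (A ^ i * B ^ j * C ^ (?D - i - j))\<bar>
            \<le> \<bar>real_of_rat (of_int d * ?c i j)\<bar> * M ^ ?D"
          by (intro mult_left_mono) (auto simp: k power_add)
      qed
      also have "\<dots> = L0 * M ^ ?D" by (simp add: L0_def sum_distrib_right case_prod_unfold)
      also have "\<dots> \<le> (L0 + 1) * M ^ ?D" using M0 by (intro mult_right_mono) auto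
      finally show "\<bar>real_of_rat x\<bar> \<le> (L0 + 1) * M ^ ?D" .
      have pow: "padic_abs p (C ^ n) = padic_abs p C ^ n" for n
        by (induction n) (simp_all add: p padic_abs_mult)
      \<comment> \<open>The integer \<open>d\<close> has p-adic absolute value at most 1, so
        dropping it only enlarges the bound.\<close>
      show "padic_abs p x \<le> padic_abs p C ^ ?D * padic_abs p (eval2 F (A / C) (B / C))"
        using padic_abs_of_int_le_1[OF p, of d]
        by (simp add: x_def padic_abs_mult[OF p] pow mult_left_le_one_le)
    qed (use L0 M0 in auto)
    finally show "1 \<le> (L0 + 1) * M ^ ?D * (padic_abs p C ^ ?D * padic_abs p (eval2 F (A / C) (B / C)))" .
  qed (use L0 in auto)
qed

text \<open>Monomials are compared one by one; \<open>1 \<le> M\<close> bounds every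
  \<open>M ^ (i + j)\<close> by the power at the total degree, and \<open>m\<close> bounds all
  coefficients at once.\<close>

lemma eval2_padic_lipschitz:
  fixes x' y' :: "'p::prime_card padic"
  assumes "1 \<le> M" "padic_norm x' \<le> M" "padic_norm y' \<le> M"
  obtains L where "L > 0" "\<And>x y e. padic_norm x \<le> M \<Longrightarrow> padic_norm y \<le> M \<Longrightarrow>
    padic_norm (x - x') \<le> e \<Longrightarrow> padic_norm (y - y') \<le> e \<Longrightarrow>
    padic_norm (eval2 F x y - eval2 F x' y') \<le> L * e"
proof -
  define c where "c = (\<lambda>(i, j). padic_norm (of_rat (coeff (coeff F j) i) :: 'p padic))"
  define m where "m = (\<Sum>ij\<in>monomials F. c ij)"
  have m: "c ij \<le> m" if "ij \<in> monomials F" for ij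
    unfolding m_def using finite_monomials that by (intro member_le_sum) (auto simp: c_def)
  have m0: "m \<ge> 0" unfolding m_def c_def by (intro sum_nonneg) auto
  let ?L = "(m + 1) * M ^ total_degree F"
  show ?thesis
  proof (rule that[of ?L])
    show "?L > 0" using m0 assms(1) by simp
    fix x y :: "'p padic" and e
    assume xy: "padic_norm x \<le> M" "padic_norm y \<le> M" "padic_norm (x - x') \<le> e" "padic_norm (y - y') \<le> e"
    have e: "0 \<le> e" using xy(3) padic_norm_nonneg order_trans by blast
    have "eval2 F x y - eval2 F x' y' = (\<Sum>(i, j)\<in>monomials F.
        of_rat (coeff (coeff F j) i) * (x ^ i * y ^ j - x' ^ i * y' ^ j))"
      by (simp add: eval2_eq_sum_monomials case_prod_unfold sum_subtractf right_diff_distrib)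
    also have "padic_norm \<dots> \<le> ?L * e"
    proof (intro padic_norm_sum_le, safe)
      fix i j assume ij: "(i, j) \<in> monomials F"
      have "padic_norm (x ^ i * y ^ j - x' ^ i * y' ^ j) \<le> M ^ (i + j) * e"
        using xy assms by (intro padic_norm_monomial_diff_le) auto
      also have "\<dots> \<le> M ^ total_degree F * e"
        using monomial_le_total_degree[OF ij] assms(1) e by (intro mult_right_mono power_increasing) auto
      finally have "c (i, j) * padic_norm (x ^ i * y ^ j - x' ^ i * y' ^ j) \<le> (m + 1) * (M ^ total_degree F * e)"
        using m[OF ij] m0 by (intro mult_mono) auto
      thus "padic_norm (of_rat (coeff (coeff F j) i) * (x ^ i * y ^ j - x' ^ i * y' ^ j)) \<le> ?L * e"
        by (simp add: padic_norm_mult c_def mult.assoc)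
    qed (use m0 assms(1) e in auto)
    finally show "padic_norm (eval2 F x y - eval2 F x' y') \<le> ?L * e" .
  qed
qed

section \<open>Valuations and norms\<close>

lemma padic_abs_add_eq:
  assumes p: "prime p" and "padic_abs p y < padic_abs p x"
  shows "padic_abs p (x + y) = padic_abs p x"
  using padic_abs_add_le_max[OF p, of x y] padic_abs_add_le_max[OF p, of "x + y" "- y"] assms by auto

lemma padic_abs_eq_powr:
  assumes "prime p" "x \<noteq> 0"
  shows "padic_abs p x = real p powr - real_of_int (padic_ord p x)"
  using assms prime_gt_0_nat[of p] by (simp add: padic_abs_def flip: powr_real_of_int')

text \<open>At \<open>x = 0\<close> both sides hold: the valuation is infinite and the absolute
  value is 0.\<close>

lemma le_padic_valuation_iff:
  assumes p: "prime p"
  shows "ereal t \<le> padic_valuation p x \<longleftrightarrow> padic_abs p x \<le> real p powr - t"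
  using prime_gt_1_nat[OF p] by (auto simp: padic_valuation_def padic_abs_eq_powr[OF p])

lemma padic_abs_inverse:
  assumes p: "prime p" shows "padic_abs p (1 / x) = 1 / padic_abs p x"
proof (cases "x = 0")
  case False
  have "padic_abs p (1 / x) * padic_abs p x = 1"
    using False p by (simp flip: padic_abs_mult[OF p])
  thus ?thesis using False p by (simp add: field_simps)
qed simp

text \<open>The inverse follows the sign convention of \<open>mcf_k\<close>: \<open>k\<close> is
  positive exactly when \<open>x\<close> is p-adically larger than 1.\<close>

lemma padic_abs_eq_powr_valuation_inverse:
  assumes p: "prime p" and x: "x \<noteq> 0"
  obtains k where "padic_valuation p (1 / x) = ereal k" "padic_abs p x = real p powr k"
proof
  show "padic_valuation p (1 / x) = ereal (real_of_int (padic_ord p (1 / x)))"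
    using x by (simp add: padic_valuation_def)
  have "1 / padic_abs p x = real p powr - real_of_int (padic_ord p (1 / x))"
    using x padic_abs_eq_powr[OF p, of "1 / x"] by (simp add: padic_abs_inverse[OF p])
  thus "padic_abs p x = real p powr real_of_int (padic_ord p (1 / x))"
    using x p prime_gt_0_nat[OF p] by (simp add: powr_minus field_simps)
qed

section \<open>Growth of the convergents\<close>

lemma mcf_rec_in_p_fractions:
  assumes "p > 0" "\<And>k. a k \<in> p_fractions p" "\<And>k. b k \<in> p_fractions p"
    and "x \<in> p_fractions p" "y \<in> p_fractions p" "z \<in> p_fractions p"
  shows "mcf_rec a b x y z n \<in> p_fractions p"
  using assms(2-)
  by (induction a b x y z n rule: mcf_rec.induct)
     (auto intro!: p_fractions_add[OF assms(1)] p_fractions_mult)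

text \<open>The condition on \<open>\<rho>\<close> says that \<open>\<rho> ^ n\<close> is a
  supersolution of the recurrence with both coefficients replaced by their bound
  \<open>h\<close>.\<close>

lemma mcf_rec_growth:
  fixes h \<rho> :: real
  assumes h: "\<And>k. \<bar>real_of_rat (a k)\<bar> \<le> h" "\<And>k. \<bar>real_of_rat (b k)\<bar> \<le> h"
    and \<rho>: "\<rho> \<ge> 1" "h * \<rho>\<^sup>2 + h * \<rho> + 1 \<le> \<rho> ^ 3"
  obtains c where "c \<ge> 0" "\<And>n. \<bar>real_of_rat (mcf_rec a b x y z n)\<bar> \<le> c * \<rho> ^ n"
proof -
  define X where "X n = \<bar>real_of_rat (mcf_rec a b x y z n)\<bar>" for n
  define c where "c = X 0 + X 1 + X 2"
  have c: "0 \<le> c" "X 0 \<le> c" "X 1 \<le> c" "X 2 \<le> c" by (simp_all add: c_def X_def)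
  have rec: "X (n + 3) \<le> h * X (n + 2) + h * X (n + 1) + X n" for n
  proof -
    have "X (n + 3) \<le> \<bar>real_of_rat (a (n + 3))\<bar> * X (n + 2) + \<bar>real_of_rat (b (n + 3))\<bar> * X (n + 1) + X n"
      unfolding X_def abs_mult[symmetric]
      by (simp only: numeral_3_eq_3 add_Suc_right add_0_right mcf_rec.simps of_rat_add of_rat_mult
          numeral_2_eq_2 One_nat_def)
    also have "\<dots> \<le> h * X (n + 2) + h * X (n + 1) + X n"
      by (intro add_mono mult_right_mono h order.refl) (simp_all add: X_def)
    finally show ?thesis .
  qed
  have h0: "h \<ge> 0" using h(1)[of 0] by linarith
  \<comment> \<open>The recurrence has order three, so the induction carries three consecutive
    bounds.\<close>
  have bound: "X n \<le> c * \<rho> ^ n \<and> X (n + 1) \<le> c * \<rho> ^ (n + 1) \<and> X (n + 2) \<le> c * \<rho> ^ (n + 2)" for n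
  proof (induction n)
    case 0
    have "c * 1 \<le> c * \<rho> ^ k" for k using \<rho>(1) c(1) by (intro mult_left_mono one_le_power)
    from this[of 0] this[of 1] this[of 2] c show ?case by (simp add: numeral_2_eq_2)
  next
    case (Suc n)
    have "X (n + 3) \<le> h * (c * \<rho> ^ (n + 2)) + h * (c * \<rho> ^ (n + 1)) + c * \<rho> ^ n"
      using Suc h0 by (intro order_trans[OF rec] add_mono mult_left_mono) auto
    also have "\<dots> = c * \<rho> ^ n * (h * \<rho>\<^sup>2 + h * \<rho> + 1)" by (simp add: power_add power2_eq_square algebra_simps)
    also have "\<dots> \<le> c * \<rho> ^ n * \<rho> ^ 3" using c(1) \<rho> by (intro mult_left_mono) auto
    finally have "X (n + 3) \<le> c * \<rho> ^ (n + 3)" by (simp add: power_add mult_ac)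
    thus ?case using Suc by (simp add: numeral_3_eq_3)
  qed
  show ?thesis by (rule that[OF c(1)]) (use bound in \<open>auto simp: X_def\<close>)
qed

section \<open>The p-adic Jacobi--Perron algorithm\<close>

text \<open>By \<open>balanced_head_unique\<close> these three properties determine
  \<open>browkin_s\<close>; from here on digit expansions do not appear.\<close>

lemma browkin_s_properties:
  fixes \<alpha> :: "'p::prime_card padic"
  assumes odd: "odd CARD('p)"
  shows browkin_s_in_p_fractions: "browkin_s \<alpha> \<in> p_fractions CARD('p)"
    and browkin_s_less: "\<bar>browkin_s \<alpha>\<bar> < of_nat CARD('p) / 2"
    and padic_norm_diff_browkin_s: "padic_norm (\<alpha> - of_rat (browkin_s \<alpha>)) < 1"
proof -
  obtain k x where ex: "balanced_expansion \<alpha> k x" using balanced_expansion_exists[OF odd] by blast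
  note head = balanced_expansion_head[OF odd ex, folded browkin_s_eq[OF odd ex]]
  show "browkin_s \<alpha> \<in> p_fractions CARD('p)" using head(1) by (auto intro: p_fractionsI)
  show "\<bar>browkin_s \<alpha>\<bar> < of_nat CARD('p) / 2" "padic_norm (\<alpha> - of_rat (browkin_s \<alpha>)) < 1"
    by (rule head)+
qed

text \<open>Zero has the three determining properties, so uniqueness applies. Consequently a nonzero
  \<open>b k\<close> forces the complete quotient \<open>v k\<close> to have norm at least
  1.\<close>

lemma browkin_s_eq_0:
  fixes \<alpha> :: "'p::prime_card padic"
  assumes odd: "odd CARD('p)" and "padic_norm \<alpha> < 1"
  shows "browkin_s \<alpha> = 0"
proof -
  obtain c m where "browkin_s \<alpha> = of_int c / of_nat CARD('p) ^ m"
    using browkin_s_in_p_fractions[OF odd, of \<alpha>] by (auto simp: p_fractions_def)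
  thus ?thesis
    by (rule balanced_head_unique[OF _ browkin_s_less[OF odd] padic_norm_diff_browkin_s[OF odd], of _ _ _ 0 0])
       (use assms(2) in auto)
qed

locale padic_jacobi_perron =
  fixes p :: nat and u v :: "nat \<Rightarrow> 'p::prime_card padic" and a b :: "nat \<Rightarrow> rat"
  assumes p_eq: "p = CARD('p)" and odd_card: "odd CARD('p)"
    and a_eq: "a k = browkin_s (u k)" and b_eq: "b k = browkin_s (v k)"
    and v_neq: "v k \<noteq> of_rat (b k)"
    and u_Suc: "u (Suc k) = 1 / (v k - of_rat (b k))"
    and v_Suc: "v (Suc k) = (u k - of_rat (a k)) / (v k - of_rat (b k))"
begin

abbreviation "absp \<equiv> padic_abs p"
abbreviation "C \<equiv> mcf_C a b"

section \<open>Absolute values of partial and complete quotients\<close>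

lemma prime_p: "prime p"
  by (simp add: p_eq prime_card)

lemma norm_u_diff: "padic_norm (u k - of_rat (a k)) < 1"
  by (simp add: a_eq padic_norm_diff_browkin_s[OF odd_card])

lemma norm_v_diff: "padic_norm (v k - of_rat (b k)) < 1" "padic_norm (v k - of_rat (b k)) > 0"
  using v_neq[of k] padic_norm_nonneg[of "v k - of_rat (b k)"] padic_norm_diff_browkin_s[OF odd_card, of "v k"]
  by (auto simp: b_eq less_le simp del: padic_norm_nonneg)

lemma norm_u_gt_1: "k > 0 \<Longrightarrow> padic_norm (u k) > 1"
  using norm_v_diff[of "k - 1"] u_Suc[of "k - 1"] by (simp add: padic_norm_divide)

text \<open>The quotient \<open>v k / u k\<close> equals \<open>u (k - 1) - a (k - 1)\<close>, a
  fractional part of norm below 1.\<close>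

lemma norm_v_less_norm_u: "k > 0 \<Longrightarrow> padic_norm (v k) < padic_norm (u k)"
  using norm_v_diff[of "k - 1"] u_Suc[of "k - 1"] v_Suc[of "k - 1"] norm_u_diff[of "k - 1"]
  by (simp add: padic_norm_divide divide_strict_right_mono)

text \<open>Removing a fractional part of norm below 1 does not change a norm above 1. The initial
  \<open>u 0\<close> is arbitrary, hence \<open>k > 0\<close>.\<close>

lemma abs_a: "k > 0 \<Longrightarrow> absp (a k) = padic_norm (u k)"
  using padic_norm_eq_if_diff_less[of "u k" "of_rat (a k)"] norm_u_gt_1[of k] norm_u_diff[of k]
  by (simp add: padic_norm_of_rat p_eq)

lemma norm_v_ge_1: "b k \<noteq> 0 \<Longrightarrow> padic_norm (v k) \<ge> 1"
  using browkin_s_eq_0[OF odd_card, of "v k"] by (auto simp: b_eq not_less[symmetric])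

lemma abs_b: "b k \<noteq> 0 \<Longrightarrow> absp (b k) = padic_norm (v k)"
  using padic_norm_eq_if_diff_less[of "v k" "of_rat (b k)"] norm_v_ge_1[of k] norm_v_diff[of k]
  by (simp add: padic_norm_of_rat p_eq)

lemma abs_b_less_abs_a: "k > 0 \<Longrightarrow> absp (b k) < absp (a k)"
  using norm_v_less_norm_u[of k] norm_u_gt_1[of k] abs_a[of k] abs_b[of k]
  by (cases "b k = 0") auto

lemma abs_a_gt_1: "k > 0 \<Longrightarrow> absp (a k) > 1"
  by (simp add: abs_a norm_u_gt_1)

section \<open>Absolute values of the denominators\<close>

lemma abs_recurrence_step:
  assumes "k > 0" "absp y \<le> absp x" "absp z \<le> absp x" "x \<noteq> 0"
  shows "absp (a k * x + b k * y + z) = absp (a k) * absp x"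
proof -
  have x: "absp x > 0" using assms(4) prime_p by (simp add: less_le)
  have "absp (b k * y) \<le> absp (b k) * absp x"
    using assms by (simp add: padic_abs_mult[OF prime_p] mult_left_mono)
  also have "\<dots> < absp (a k) * absp x" using x abs_b_less_abs_a[OF assms(1)] by simp
  finally have 1: "absp (b k * y) < absp (a k * x)" by (simp add: padic_abs_mult[OF prime_p])
  have "absp z < absp (a k) * absp x"
    using assms(3) x abs_a_gt_1[OF assms(1)] by (simp add: le_less_trans[OF assms(3)])
  with 1 have "absp (b k * y + z) < absp (a k * x)"
    using padic_abs_add_le_max[OF prime_p, of "b k * y" z] by (simp add: padic_abs_mult[OF prime_p])
  from padic_abs_add_eq[OF prime_p this] show ?thesis
    by (simp add: padic_abs_mult[OF prime_p] add.assoc)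
qed

text \<open>The leading term \<open>a k * x\<close> dominates the recurrence only if earlier
  denominators are no larger, so monotonicity and the product formula are proved together.\<close>

lemma abs_C_aux:
  "1 \<le> absp (C n) \<and> absp (C n) \<le> absp (C (n + 1)) \<and> absp (C (n + 1)) \<le> absp (C (n + 2))
   \<and> absp (C (n + 1)) = absp (a (n + 1)) * absp (C n)
   \<and> absp (C (n + 2)) = absp (a (n + 2)) * absp (C (n + 1))"
proof (induction n)
  case 0
  have C0: "C 0 = 1" and C1: "C 1 = a 1" by (simp_all add: mcf_C_def)
  have "a 1 \<noteq> 0" using abs_a_gt_1[of 1] by auto
  \<comment> \<open>The summand 0 is the initial value of index -1, written out to match the shape
    of \<open>abs_recurrence_step\<close>.\<close>
  have "absp (C 2) = absp (a 2 * C 1 + b 2 * C 0 + 0)" by (simp add: mcf_C_def numeral_2_eq_2)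
  also have "\<dots> = absp (a 2) * absp (C 1)"
    using C0 C1 abs_a_gt_1[of 1] \<open>a 1 \<noteq> 0\<close> prime_p by (intro abs_recurrence_step) auto
  finally have C2: "absp (C 2) = absp (a 2) * absp (C 1)" .
  moreover have "absp (C 1) \<le> absp (a 2) * absp (C 1)"
    using abs_a_gt_1[of 2] mult_right_mono[of 1 "absp (a 2)" "absp (C 1)"] by simp
  ultimately show ?case using C0 C1 prime_p abs_a_gt_1[of 1] by (simp add: numeral_2_eq_2)
next
  case (Suc n)
  have "absp (C (n + 3)) = absp (a (n + 3) * C (n + 2) + b (n + 3) * C (n + 1) + C n)"
    by (simp add: mcf_C_def numeral_3_eq_3)
  also have "\<dots> = absp (a (n + 3)) * absp (C (n + 2))"
  proof (rule abs_recurrence_step)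
    have "absp (C (n + 2)) \<ge> 1" "absp (C n) \<le> absp (C (n + 2))" using Suc by linarith+
    thus "C (n + 2) \<noteq> 0" "absp (C n) \<le> absp (C (n + 2))" by auto
  qed (use Suc in auto)
  finally have C3: "absp (C (n + 3)) = absp (a (n + 3)) * absp (C (n + 2))" .
  moreover have "absp (C (n + 2)) \<le> absp (a (n + 3)) * absp (C (n + 2))"
    using abs_a_gt_1[of "n + 3"] mult_right_mono[of 1 "absp (a (n + 3))" "absp (C (n + 2))"] by simp
  ultimately have mono: "absp (C (n + 2)) \<le> absp (C (n + 3))" by simp
  have idx: "Suc n = n + 1" "n + 1 + 1 = n + 2" "n + 1 + 2 = n + 3" by simp_all
  show ?case unfolding idx using Suc C3 mono by (intro conjI) linarith+
qed

lemma abs_C_ge_1: "1 \<le> absp (C n)"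
  using abs_C_aux[of n] by simp

section \<open>Linear forms in the convergents\<close>

text \<open>Substitute \<open>u k = a k + v (Suc k) / u (Suc k)\<close> and
  \<open>v k = b k + 1 / u (Suc k)\<close>, then multiply by \<open>u (Suc k)\<close>. The bracket
  is the next term of the recurrence.\<close>

lemma complete_quotient_step:
  assumes "u k * x + v k * y + z = 0"
  shows "u (Suc k) * (of_rat (a k) * x + of_rat (b k) * y + z) + v (Suc k) * x + y = 0"
proof -
  define d where "d = v k - of_rat (b k)"
  have d: "d \<noteq> 0" using v_neq by (simp add: d_def)
  have "of_rat (a k) * x + of_rat (b k) * y + z = - ((u k - of_rat (a k)) * x + d * y)"
    using assms by (simp add: d_def algebra_simps eq_neg_iff_add_eq_0)
  moreover have "1 / d * (- ((u k - of_rat (a k)) * x + d * y)) + (u k - of_rat (a k)) / d * x + y = 0"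
    using d by (simp add: field_simps)
  ultimately show ?thesis unfolding u_Suc v_Suc d_def[symmetric] by simp
qed

text \<open>\<open>x\<close>, \<open>y\<close>, \<open>z\<close> are the values at indices -2, -1,
  0, and the assumption is the relation with \<open>u 1\<close>, \<open>v 1\<close>. As
  \<open>T\<close> starts at index 0, two steps lead to the base case.\<close>

lemma mcf_rec_relation:
  fixes \<gamma> :: "'p padic" and x y z x' y' z' :: rat
  defines "T \<equiv> \<lambda>n. of_rat (mcf_rec a b x y z n) - \<gamma> * of_rat (mcf_rec a b x' y' z' n)"
  assumes "u 1 * (of_rat z - \<gamma> * of_rat z') + v 1 * (of_rat y - \<gamma> * of_rat y') + (of_rat x - \<gamma> * of_rat x') = 0"
  shows "u (n + 3) * T (n + 2) + v (n + 3) * T (n + 1) + T n = 0"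
proof (induction n)
  case 0
  have "u 2 * T 1 + v 2 * (of_rat z - \<gamma> * of_rat z') + (of_rat y - \<gamma> * of_rat y') = 0"
    using complete_quotient_step[OF assms(2)]
    by (simp add: T_def of_rat_add of_rat_mult numeral_2_eq_2 algebra_simps)
  from complete_quotient_step[OF this] show ?case
    by (simp add: T_def of_rat_add of_rat_mult numeral_2_eq_2 numeral_3_eq_3 algebra_simps)
next
  case (Suc n)
  from complete_quotient_step[OF Suc] show ?case
    by (simp add: T_def of_rat_add of_rat_mult numeral_2_eq_2 numeral_3_eq_3 algebra_simps)
qed

text \<open>The initial forms are 0, 1 and \<open>a 0 - u 0\<close>, and
  \<open>v 1 = u 1 * (u 0 - a 0)\<close>.\<close>

lemma alpha_relation:
  defines "T \<equiv> \<lambda>n. of_rat (mcf_A a b n) - u 0 * of_rat (C n)"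
  shows "u (n + 3) * T (n + 2) + v (n + 3) * T (n + 1) + T n = 0"
  unfolding T_def mcf_A_def mcf_C_def
  by (rule mcf_rec_relation) (use v_neq[of 0] in \<open>simp add: u_Suc v_Suc field_simps\<close>)

text \<open>The initial forms are 1, 0 and \<open>b 0 - v 0\<close>, and
  \<open>u 1 * (v 0 - b 0) = 1\<close>.\<close>

lemma beta_relation:
  defines "T \<equiv> \<lambda>n. of_rat (mcf_B a b n) - v 0 * of_rat (C n)"
  shows "u (n + 3) * T (n + 2) + v (n + 3) * T (n + 1) + T n = 0"
  unfolding T_def mcf_B_def mcf_C_def
  by (rule mcf_rec_relation) (use v_neq[of 0] in \<open>simp add: u_Suc v_Suc field_simps\<close>)

text \<open>Solving the relation for \<open>T (n + 2)\<close> divides by the large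
  \<open>u (n + 3)\<close>; \<open>H1\<close> and \<open>H2\<close> say that this gain pays for the
  growth of the weight attached to \<open>T\<close>.\<close>

lemma relation_decay:
  fixes T :: "nat \<Rightarrow> 'p padic" and d D :: nat
  assumes rel: "\<And>n. u (n + 3) * T (n + 2) + v (n + 3) * T (n + 1) + T n = 0"
    and H1: "\<And>n. n \<ge> n0 \<Longrightarrow>
      (absp (a (n + 2)) * absp (a (n + 1))) ^ d * real p ^ (2 * D) \<le> padic_norm (u (n + 3))"
    and H2: "\<And>n. n \<ge> n0 \<Longrightarrow>
      padic_norm (v (n + 3)) * (absp (a (n + 2)) ^ d * real p ^ D) \<le> padic_norm (u (n + 3))"
  obtains c where "c \<ge> 0" "\<And>n. padic_norm (T n) * (absp (C n) ^ d * real p ^ (D * n)) \<le> c"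
proof -
  let ?q = "real p"
  define E where "E n = padic_norm (T n) * (absp (C n) ^ d * ?q ^ (D * n))" for n
  have E0: "E n \<ge> 0" for n by (simp add: E_def)
  have C1: "absp (C (n + 1)) = absp (a (n + 1)) * absp (C n)"
    and C2: "absp (C (n + 2)) = absp (a (n + 2)) * absp (C (n + 1))" for n
    using abs_C_aux by blast+
  have step: "E (n + 2) \<le> max (E (n + 1)) (E n)" if n: "n \<ge> n0" for n
  proof -
    let ?U = "padic_norm (u (n + 3))" and ?V = "padic_norm (v (n + 3))"
    have U: "?U > 0" using norm_u_gt_1[of "n + 3"] by simp
    define W where "W = absp (C (n + 2)) ^ d * ?q ^ (D * (n + 2))"
    have W: "W \<ge> 0" by (simp add: W_def)
    have "u (n + 3) * T (n + 2) = - (v (n + 3) * T (n + 1) + T n)"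
      using rel[of n] by (simp only: eq_neg_iff_add_eq_0 add.assoc)
    hence "?U * padic_norm (T (n + 2)) \<le> max (?V * padic_norm (T (n + 1))) (padic_norm (T n))"
      using padic_norm_add_le_max[of "v (n + 3) * T (n + 1)" "T n"]
      by (metis padic_norm_minus padic_norm_mult)
    hence "?U * padic_norm (T (n + 2)) * W \<le> max (?V * padic_norm (T (n + 1))) (padic_norm (T n)) * W"
      using W by (rule mult_right_mono)
    hence "?U * E (n + 2) \<le> max (?V * padic_norm (T (n + 1)) * W) (padic_norm (T n) * W)"
      using W by (simp add: E_def W_def mult.assoc max_mult_distrib_right)
    \<comment> \<open>The weight grows from index \<open>n + 1\<close> by exactly the factor in
      \<open>H2\<close>; from index \<open>n\<close> it grows by the factor in \<open>H1\<close>,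
      see \<open>W2\<close>.\<close>
    moreover have W1: "W = absp (a (n + 2)) ^ d * ?q ^ D * (absp (C (n + 1)) ^ d * ?q ^ (D * (n + 1)))"
      unfolding W_def C2 power_mult_distrib by (simp add: power_add mult_ac)
    have "?V * padic_norm (T (n + 1)) * W = ?V * (absp (a (n + 2)) ^ d * ?q ^ D) * E (n + 1)"
      unfolding W1 E_def by (simp only: mult_ac)
    moreover have "?V * (absp (a (n + 2)) ^ d * ?q ^ D) * E (n + 1) \<le> ?U * E (n + 1)"
      using H2[OF n] E0 by (rule mult_right_mono)
    moreover have W2: "W = (absp (a (n + 2)) * absp (a (n + 1))) ^ d * ?q ^ (2 * D) * (absp (C n) ^ d * ?q ^ (D * n))"
      unfolding W_def C2 C1 power_mult_distrib by (simp add: power_add mult_2 mult_2_right mult_ac)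
    have "padic_norm (T n) * W
        = (absp (a (n + 2)) * absp (a (n + 1))) ^ d * ?q ^ (2 * D) * E n"
      unfolding W2 E_def by (simp only: mult_ac)
    moreover have "(absp (a (n + 2)) * absp (a (n + 1))) ^ d * ?q ^ (2 * D) * E n \<le> ?U * E n"
      using H1[OF n] E0 by (rule mult_right_mono)
    ultimately have "?U * E (n + 2) \<le> max (?U * E (n + 1)) (?U * E n)" by linarith
    thus ?thesis using U by (simp add: le_max_iff_disj)
  qed
  \<comment> \<open>A sum of nonnegative terms stands in for their maximum; it includes both
    predecessors of index \<open>n0 + 2\<close>, the first one covered by
    \<open>step\<close>.\<close>
  define c where "c = (\<Sum>i\<le>n0 + 1. E i)"
  have init: "E i \<le> c" if "i \<le> n0 + 1" for i
    unfolding c_def using that E0 by (intro member_le_sum) auto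
  have "E n \<le> c" for n
  proof (induction n rule: less_induct)
    case (less n)
    show ?case
    proof (cases "n \<le> n0 + 1")
      case False
      then obtain m where m: "n = m + 2" "m \<ge> n0" 
        by (intro that[of "n - 2"]) auto
      thus ?thesis using step[of m] less[of m] less[of "m + 1"] by auto
    qed (rule init)
  qed
  moreover have "c \<ge> 0" unfolding c_def using E0 by (intro sum_nonneg) auto
  ultimately show ?thesis using that unfolding E_def by blast
qed

lemma abs_C_pos: "absp (C n) > 0"
  using abs_C_ge_1[of n] by linarith

lemma C_neq_0: "C n \<noteq> 0"
  using abs_C_pos[of n] by auto

text \<open>Dividing by \<open>C n\<close> raises the exponent \<open>d\<close> to
  \<open>Suc d\<close>; with \<open>d = D - 1\<close> this is the power of \<open>C n\<close> that
  homogenizing \<open>F\<close> introduces.\<close>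

lemma convergent_distance:
  fixes X :: "nat \<Rightarrow> rat" and \<gamma> :: "'p padic" and d D :: nat
  assumes "padic_norm (of_rat (X n) - \<gamma> * of_rat (C n)) * (absp (C n) ^ d * real p ^ (D * n)) \<le> c"
  shows "padic_norm (of_rat (X n / C n) - \<gamma>) \<le> c / (absp (C n) ^ Suc d * real p ^ (D * n))"
proof -
  have q: "real p > 0" using prime_gt_0_nat[OF prime_p] by simp
  have "of_rat (X n / C n) - \<gamma> = (of_rat (X n) - \<gamma> * of_rat (C n)) / of_rat (C n)"
    using C_neq_0[of n] by (simp add: of_rat_divide field_simps)
  hence N: "padic_norm (of_rat (X n / C n) - \<gamma>)
      = padic_norm (of_rat (X n) - \<gamma> * of_rat (C n)) / absp (C n)"
    by (simp add: padic_norm_divide padic_norm_of_rat p_eq)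
  have "padic_norm (of_rat (X n / C n) - \<gamma>) * (absp (C n) ^ Suc d * real p ^ (D * n)) \<le> c"
    unfolding N using assms abs_C_pos[of n] by (simp add: mult_ac)
  thus ?thesis using abs_C_pos[of n] q by (subst pos_le_divide_eq) auto
qed

section \<open>Archimedean size of the convergents\<close>

text \<open>What counts is a base strictly below \<open>p\<close>, so that the p-adic decay
  outweighs the archimedean growth.\<close>

lemma growth_A_B_C:
  obtains c where "c \<ge> 0"
    "\<And>n. \<bar>real_of_rat (mcf_A a b n)\<bar> \<le> c * (5 / 6 * real p) ^ n"
    "\<And>n. \<bar>real_of_rat (mcf_B a b n)\<bar> \<le> c * (5 / 6 * real p) ^ n"
    "\<And>n. \<bar>real_of_rat (C n)\<bar> \<le> c * (5 / 6 * real p) ^ n"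
proof -
  define \<rho> where "\<rho> = 5 / 6 * real p"
  have "p \<noteq> 2" using odd_card p_eq by auto
  hence p3: "real p \<ge> 3" using prime_ge_2_nat[OF prime_p] by linarith
  have \<rho>: "\<rho> \<ge> 1" using p3 by (simp add: \<rho>_def)
  \<comment> \<open>For \<open>p \<ge> 3\<close> the dominant root of \<open>x^3 = p/2 * (x^2 + x) + 1\<close> is below \<open>5 p / 6 < p\<close>.\<close>
  have cube: "real p / 2 * \<rho>\<^sup>2 + real p / 2 * \<rho> + 1 \<le> \<rho> ^ 3"
  proof -
    have sq: "real p ^ 2 \<ge> 9" using power_mono[of 3 "real p" 2] p3 by simp
    \<comment> \<open>With this the difference below is at least \<open>5 / 18 * p^2 - 1\<close>,
      which is positive once \<open>p^2\<close> is at least 9.\<close>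
    have "real p ^ 3 \<ge> 3 * real p ^ 2"
      using mult_right_mono[of 3 "real p" "real p ^ 2"] p3 by (simp add: power2_eq_square power3_eq_cube)
    moreover have "\<rho> ^ 3 - (real p / 2 * \<rho>\<^sup>2 + real p / 2 * \<rho> + 1)
        = 25 / 108 * real p ^ 3 - 5 / 12 * real p ^ 2 - 1"
      by (simp add: \<rho>_def power2_eq_square power3_eq_cube field_simps)
    ultimately show ?thesis using sq by linarith
  qed
  have half: "\<bar>real_of_rat (browkin_s z)\<bar> \<le> real p / 2" for z :: "'p padic"
  proof -
    have "\<bar>browkin_s z\<bar> < of_nat CARD('p) / 2" by (rule browkin_s_less[OF odd_card])
    hence "real_of_rat \<bar>browkin_s z\<bar> < real_of_rat (of_nat CARD('p) / 2)" by (simp only: of_rat_less)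
    thus ?thesis by (simp add: of_rat_divide p_eq)
  qed
  have growth: "\<exists>c\<ge>0. \<forall>n. \<bar>real_of_rat (mcf_rec a b x y z n)\<bar> \<le> c * \<rho> ^ n" for x y z
    using mcf_rec_growth[of a "real p / 2" b \<rho> x y z] half \<rho> cube by (metis a_eq b_eq)
  obtain cA cB cC where c: "cA \<ge> 0" "cB \<ge> 0" "cC \<ge> 0"
    "\<And>n. \<bar>real_of_rat (mcf_A a b n)\<bar> \<le> cA * \<rho> ^ n"
    "\<And>n. \<bar>real_of_rat (mcf_B a b n)\<bar> \<le> cB * \<rho> ^ n"
    "\<And>n. \<bar>real_of_rat (C n)\<bar> \<le> cC * \<rho> ^ n"
    unfolding mcf_A_def mcf_B_def mcf_C_def using growth by metis
  have weaken: "x \<le> (cA + cB + cC) * \<rho> ^ n" if "x \<le> k * \<rho> ^ n" "k \<le> cA + cB + cC" for x k n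
    by (rule order_trans[OF that(1) mult_right_mono[OF that(2)]]) (use \<rho> in simp)
  show ?thesis
    by (rule that[of "cA + cB + cC", folded \<rho>_def];
        (rule weaken[OF c(4)] weaken[OF c(5)] weaken[OF c(6)])?; use c(1-3) in simp)
qed

lemma A_B_C_in_p_fractions:
  "mcf_A a b n \<in> p_fractions p" "mcf_B a b n \<in> p_fractions p" "C n \<in> p_fractions p"
proof -
  have "a k \<in> p_fractions p" "b k \<in> p_fractions p" for k
    by (simp_all add: a_eq b_eq p_eq browkin_s_in_p_fractions[OF odd_card])
  thus "mcf_A a b n \<in> p_fractions p" "mcf_B a b n \<in> p_fractions p" "C n \<in> p_fractions p"
    unfolding mcf_A_def mcf_B_def mcf_C_def
    using prime_gt_0_nat[OF prime_p] by (auto intro!: mcf_rec_in_p_fractions)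
qed

section \<open>From the valuation conditions to vanishing\<close>

text \<open>The conditions are exponentiated to base \<open>p\<close>. The bound
  \<open>n > 1\<close> keeps the indices \<open>n\<close> and \<open>n - 1\<close> positive, where
  partial quotients are nonzero and \<open>mcf_k\<close> is finite.\<close>

lemma valuation_conditions_imp_norm_bounds:
  assumes n: "n > 1" and D: "D > 0"
    and k: "mcf_k p a (n + 1) \<ge> ereal (real D - 1) * (mcf_k p a n + mcf_k p a (n - 1)) + ereal (2 * real D)"
    and h: "mcf_h p a b (n + 1) \<ge> ereal (real D - 1) * mcf_k p a n + ereal (real D)"
  shows "(absp (a n) * absp (a (n - 1))) ^ (D - 1) * real p ^ (2 * D) \<le> padic_norm (u (n + 1))"
    and "padic_norm (v (n + 1)) * (absp (a n) ^ (D - 1) * real p ^ D) \<le> padic_norm (u (n + 1))"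
proof -
  have q: "real p > 1" using prime_gt_1_nat[OF prime_p] by simp
  have nz: "a m \<noteq> 0" if "m > 0" for m using abs_a_gt_1[OF that] by auto
  obtain k1 where k1: "mcf_k p a n = ereal k1" "absp (a n) = real p powr k1"
    unfolding mcf_k_def using padic_abs_eq_powr_valuation_inverse[OF prime_p nz[of n]] n by auto
  obtain k0 where k0: "mcf_k p a (n - 1) = ereal k0" "absp (a (n - 1)) = real p powr k0"
    unfolding mcf_k_def using padic_abs_eq_powr_valuation_inverse[OF prime_p nz[of "n - 1"]] n by auto
  have u: "absp (a (n + 1)) = padic_norm (u (n + 1))" by (simp add: abs_a)
  have u0: "padic_norm (u (n + 1)) > 0" using norm_u_gt_1[of "n + 1"] by simp
  have D1: "real D - 1 = real (D - 1)" using D by simp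
  have pow: "real p powr (real m * x + real l) = (real p powr x) ^ m * real p ^ l" for m l x
    using q by (simp add: powr_add powr_realpow powr_power mult.commute)
  have flip: "x * real p powr t \<le> y" if "x / y \<le> real p powr - t" "y > 0" for x y t
  proof -
    have "x \<le> real p powr - t * y" using that by (simp add: pos_divide_le_eq)
    hence "x * real p powr t \<le> real p powr - t * y * real p powr t" by (rule mult_right_mono) simp
    thus ?thesis using q by (simp add: powr_minus field_simps)
  qed
  have "1 / padic_norm (u (n + 1)) \<le> real p powr - (real (D - 1) * (k1 + k0) + real (2 * D))"
    using k unfolding k1 k0 mcf_k_def[of _ _ "n + 1"] D1
    by (simp add: le_padic_valuation_iff[OF prime_p] padic_abs_inverse[OF prime_p] u[simplified] del: of_nat_diff)
  hence "real p powr (real (D - 1) * (k1 + k0) + real (2 * D)) \<le> padic_norm (u (n + 1))"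
    using flip[OF _ u0, of 1] by simp
  thus H1: "(absp (a n) * absp (a (n - 1))) ^ (D - 1) * real p ^ (2 * D) \<le> padic_norm (u (n + 1))"
    unfolding pow k1 k0 by (simp add: powr_add)
  show "padic_norm (v (n + 1)) * (absp (a n) ^ (D - 1) * real p ^ D) \<le> padic_norm (u (n + 1))"
  proof (cases "b (n + 1) = 0")
    \<comment> \<open>Here the condition on \<open>h\<close> is void, since \<open>h (n + 1) = \<infinity>\<close>; the one on \<open>k\<close> takes over.\<close>
    case True
    hence "padic_norm (v (n + 1)) \<le> 1" using norm_v_diff[of "n + 1"] by simp
    hence "padic_norm (v (n + 1)) * (absp (a n) ^ (D - 1) * real p ^ D) \<le> absp (a n) ^ (D - 1) * real p ^ D"
      by (intro mult_left_le_one_le) auto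
    also have "\<dots> \<le> (absp (a n) * absp (a (n - 1))) ^ (D - 1) * real p ^ (2 * D)"
      using abs_a_gt_1[of n] abs_a_gt_1[of "n - 1"] n q
      by (intro mult_mono power_mono power_increasing) auto
    finally show ?thesis using H1 by linarith
  next
    case False
    have "absp (b (n + 1) / a (n + 1)) = padic_norm (v (n + 1)) / padic_norm (u (n + 1))"
      using abs_b[OF False] padic_abs_mult[OF prime_p, of "b (n + 1)" "1 / a (n + 1)"]
      by (simp add: padic_abs_inverse[OF prime_p] u del: One_nat_def)
    hence "padic_norm (v (n + 1)) / padic_norm (u (n + 1)) \<le> real p powr - (real (D - 1) * k1 + real D)"
      using h unfolding k1 mcf_h_def D1
      by (simp add: le_padic_valuation_iff[OF prime_p] del: of_nat_diff)
    hence "padic_norm (v (n + 1)) * real p powr (real (D - 1) * k1 + real D) \<le> padic_norm (u (n + 1))"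
      by (rule flip[OF _ u0])
    thus ?thesis unfolding pow k1 .
  qed
qed

theorem eventually_eval2_convergents_eq_0:
  assumes F: "F \<noteq> 0" "eval2 F (u 0) (v 0) = 0" and D: "D = total_degree F"
    and ev: "\<forall>\<^sub>F n in sequentially.
           mcf_k p a (n + 1) \<ge> ereal (real D - 1) * (mcf_k p a n + mcf_k p a (n - 1)) + ereal (2 * real D) \<and>
           mcf_h p a b (n + 1) \<ge> ereal (real D - 1) * mcf_k p a n + ereal (real D)"
  shows "\<forall>\<^sub>F n in sequentially. eval2 F (convergent_alpha a b n) (convergent_beta a b n) = 0"
proof -
  let ?q = "real p" and ?\<alpha> = "u 0" and ?\<beta> = "v 0"
  have q: "?q > 1" using prime_gt_1_nat[OF prime_p] by simp
  have D0: "D > 0" using total_degree_pos_if_root[OF F] D by simp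
  obtain n0 where n0: "\<And>n. n \<ge> n0 \<Longrightarrow>
      mcf_k p a (n + 1) \<ge> ereal (real D - 1) * (mcf_k p a n + mcf_k p a (n - 1)) + ereal (2 * real D)"
    "\<And>n. n \<ge> n0 \<Longrightarrow> mcf_h p a b (n + 1) \<ge> ereal (real D - 1) * mcf_k p a n + ereal (real D)"
    using ev unfolding eventually_sequentially by blast
  \<comment> \<open>The conditions are read off at \<open>n + 2\<close>, which exceeds 1 for every
    \<open>n\<close>, so that \<open>a 0\<close> never enters.\<close>
  have H1: "(absp (a (n + 2)) * absp (a (n + 1))) ^ (D - 1) * ?q ^ (2 * D) \<le> padic_norm (u (n + 3))"
    and H2: "padic_norm (v (n + 3)) * (absp (a (n + 2)) ^ (D - 1) * ?q ^ D) \<le> padic_norm (u (n + 3))"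
    if "n \<ge> n0" for n
    using valuation_conditions_imp_norm_bounds[of "n + 2", OF _ D0 n0] that
    by (simp_all add: numeral_3_eq_3)
  obtain c1 where c1: "c1 \<ge> 0" "\<And>n. padic_norm (of_rat (mcf_A a b n) - ?\<alpha> * of_rat (C n))
      * (absp (C n) ^ (D - 1) * ?q ^ (D * n)) \<le> c1"
    using relation_decay[OF alpha_relation H1 H2] by blast
  obtain c2 where c2: "c2 \<ge> 0" "\<And>n. padic_norm (of_rat (mcf_B a b n) - ?\<beta> * of_rat (C n))
      * (absp (C n) ^ (D - 1) * ?q ^ (D * n)) \<le> c2"
    using relation_decay[OF beta_relation H1 H2] by blast
  define c where "c = max c1 c2"
  have c: "c \<ge> 0" using c1(1) by (simp add: c_def)
  define e where "e n = c / (absp (C n) ^ D * ?q ^ (D * n))" for n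
  have Q: "padic_norm (of_rat (convergent_alpha a b n) - ?\<alpha>) \<le> e n"
    "padic_norm (of_rat (convergent_beta a b n) - ?\<beta>) \<le> e n" for n
    unfolding convergent_alpha_def convergent_beta_def e_def
    using convergent_distance[of "mcf_A a b" n ?\<alpha> "D - 1" D c] c1(2)[of n]
      convergent_distance[of "mcf_B a b" n ?\<beta> "D - 1" D c] c2(2)[of n] D0
    by (auto simp: c_def)
  have e_le: "e n \<le> c" for n
  proof -
    have "1 * 1 \<le> absp (C n) ^ D * ?q ^ (D * n)"
      using abs_C_ge_1[of n] q by (intro mult_mono one_le_power) auto
    thus ?thesis using c by (simp add: e_def divide_le_eq mult_le_cancel_left1)
  qed
  \<comment> \<open>One radius for a ball containing the limits and, since
    \<open>e n \<le> c\<close>, all convergents, as the Lipschitz bound requires.\<close>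
  define M where "M = Max {1, c, padic_norm ?\<alpha>, padic_norm ?\<beta>}"
  have M: "1 \<le> M" "c \<le> M" "padic_norm ?\<alpha> \<le> M" "padic_norm ?\<beta> \<le> M" by (simp_all add: M_def)
  have QM: "padic_norm (of_rat (convergent_alpha a b n) :: 'p padic) \<le> M"
    "padic_norm (of_rat (convergent_beta a b n) :: 'p padic) \<le> M" for n
    using padic_norm_add_le_max[of "of_rat (convergent_alpha a b n) - ?\<alpha>" ?\<alpha>]
      padic_norm_add_le_max[of "of_rat (convergent_beta a b n) - ?\<beta>" ?\<beta>]
      Q[of n] e_le[of n] M by auto
  obtain L where L: "L > 0" "\<And>x y e. padic_norm x \<le> M \<Longrightarrow> padic_norm y \<le> M \<Longrightarrow>
      padic_norm (x - ?\<alpha>) \<le> e \<Longrightarrow> padic_norm (y - ?\<beta>) \<le> e \<Longrightarrow>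
      padic_norm (eval2 F x y - eval2 F ?\<alpha> ?\<beta>) \<le> L * e"
    using eval2_padic_lipschitz[OF M(1,3,4), of F] by blast
  have small: "absp (C n) ^ D * absp (eval2 F (convergent_alpha a b n) (convergent_beta a b n))
      \<le> L * c / ?q ^ (D * n)" for n
  proof -
    \<comment> \<open>Since \<open>F\<close> vanishes at the limits, the Lipschitz bound controls
      its value at the convergents themselves.\<close>
    have "absp (eval2 F (convergent_alpha a b n) (convergent_beta a b n)) \<le> L * e n"
      using L(2)[OF QM Q, of n] F(2)
      by (simp add: p_eq padic_norm_of_rat flip: of_rat_eval2)
    hence "absp (C n) ^ D * absp (eval2 F (convergent_alpha a b n) (convergent_beta a b n))
        \<le> absp (C n) ^ D * (L * e n)" by (intro mult_left_mono) auto
    also have "\<dots> = L * c / ?q ^ (D * n)" using abs_C_pos[of n] by (simp add: e_def)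
    finally show ?thesis .
  qed
  obtain g where g: "g \<ge> 0"
    "\<And>n. \<bar>real_of_rat (mcf_A a b n)\<bar> \<le> g * (5 / 6 * ?q) ^ n"
    "\<And>n. \<bar>real_of_rat (mcf_B a b n)\<bar> \<le> g * (5 / 6 * ?q) ^ n"
    "\<And>n. \<bar>real_of_rat (C n)\<bar> \<le> g * (5 / 6 * ?q) ^ n"
    using growth_A_B_C by blast
  obtain L' where L': "L' > 0"
    "\<And>A B C M. A \<in> p_fractions p \<Longrightarrow> B \<in> p_fractions p \<Longrightarrow> C \<in> p_fractions p \<Longrightarrow> C \<noteq> 0 \<Longrightarrow>
       \<bar>real_of_rat A\<bar> \<le> M \<Longrightarrow> \<bar>real_of_rat B\<bar> \<le> M \<Longrightarrow> \<bar>real_of_rat C\<bar> \<le> M \<Longrightarrow>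
       eval2 F (A / C) (B / C) \<noteq> 0 \<Longrightarrow>
       1 \<le> L' * M ^ D * (absp C ^ D * absp (eval2 F (A / C) (B / C)))"
    using eval2_product_formula[OF prime_p, of F] unfolding D by blast
  define K where "K = L' * g ^ D * (L * c)"
  \<comment> \<open>The factor \<open>?q ^ (D * n)\<close> in the archimedean bound cancels against
    the p-adic decay, leaving a geometric sequence.\<close>
  have bound: "1 \<le> K * ((5 / 6) ^ D) ^ n"
    if nz: "eval2 F (convergent_alpha a b n) (convergent_beta a b n) \<noteq> 0" for n
  proof -
    have "1 \<le> L' * (g * (5 / 6 * ?q) ^ n) ^ D
        * (absp (C n) ^ D * absp (eval2 F (convergent_alpha a b n) (convergent_beta a b n)))"
      using nz unfolding convergent_alpha_def convergent_beta_def
      by (intro L'(2) A_B_C_in_p_fractions C_neq_0 g)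
    also have "\<dots> \<le> L' * (g * (5 / 6 * ?q) ^ n) ^ D * (L * c / ?q ^ (D * n))"
      using L'(1) g(1) by (intro mult_left_mono small) auto
    also have "(g * (5 / 6 * ?q) ^ n) ^ D = g ^ D * (((5 / 6) ^ D) ^ n * ?q ^ (D * n))"
      by (simp only: power_mult_distrib power_mult[symmetric] mult.commute[of n D])
    also have "L' * \<dots> * (L * c / ?q ^ (D * n)) = K * ((5 / 6) ^ D) ^ n"
      using q by (simp add: K_def)
    finally show ?thesis .
  qed
  have "(\<lambda>n. K * ((5 / 6) ^ D) ^ n) \<longlonglongrightarrow> 0"
    using D0 by (intro tendsto_mult_right_zero LIMSEQ_power_zero) (simp add: power_less_one_iff)
  hence "\<forall>\<^sub>F n in sequentially. K * ((5 / 6) ^ D) ^ n < 1" by (rule order_tendstoD) simp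
  thus ?thesis by eventually_elim (use bound in force)
qed

end

theorem theorem22:
  fixes \<alpha> \<beta> :: "'p::prime_card padic"
    and F :: "rat poly poly"
    and D :: nat
    and a b :: "nat \<Rightarrow> rat"
  assumes "odd CARD('p)"
    and "algebraically_dependent \<alpha> \<beta>"
    and "F \<noteq> 0" and "eval2 F \<alpha> \<beta> = 0"
    and "\<And>G. G \<noteq> 0 \<Longrightarrow> eval2 G \<alpha> \<beta> = 0 \<Longrightarrow> total_degree F \<le> total_degree G"
    and "D = total_degree F"
    and "jacobi_perron_expansion \<alpha> \<beta> a b"
    and "\<forall>\<^sub>F n in sequentially.
           mcf_k CARD('p) a (n + 1) \<ge>
             ereal (real D - 1) * (mcf_k CARD('p) a n + mcf_k CARD('p) a (n - 1)) + ereal (2 * real D) \<and>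
           mcf_h CARD('p) a b (n + 1) \<ge> ereal (real D - 1) * mcf_k CARD('p) a n + ereal (real D)"
  shows "\<forall>\<^sub>F n in sequentially. eval2 F (convergent_alpha a b n) (convergent_beta a b n) = 0"
proof -
  obtain u v where uv: "u 0 = \<alpha>" "v 0 = \<beta>"
    "\<And>k. a k = browkin_s (u k) \<and> b k = browkin_s (v k) \<and> v k \<noteq> of_rat (b k) \<and>
      u (Suc k) = 1 / (v k - of_rat (b k)) \<and> v (Suc k) = (u k - of_rat (a k)) / (v k - of_rat (b k))"
    using assms(7) unfolding jacobi_perron_expansion_def by blast
  interpret padic_jacobi_perron "CARD('p)" u v a b
    by unfold_locales (use assms(1) uv(3) in blast)+
  show ?thesis
    using eventually_eval2_convergents_eq_0[OF assms(3) _ assms(6,8)] assms(4) uv(1,2) by simp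
qed

end
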